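(* Let $f=(H\circ\mathsf{y}+i\mathsf{y},\mathsf{t}):\mathbb{R}^n\to\mathbb{H}^1$ be a harmonic curve on $\Omega=\mathbb{R}^n$ such that $$\sup_{\mathbb{R}^n}\left|\frac{(H''\circ\mathsf{y})(H'\circ\mathsf{y})}{1+(H'\circ\mathsf{y})^2}\,\mathsf{y}\right|<1$$ and $\mathsf{y}$ is bounded in $\mathbb{R}^n$. Then $f$ is constant.
   Context: The first Heisenberg group $\mathbb{H}^1$ is $\mathbb{R}^3$ with coordinates $(\mathsf{x},\mathsf{y},\mathsf{t})$ and contact form $\theta=d\mathsf{t}+2(\mathsf{x}\,d\mathsf{y}-\mathsf{y}\,d\mathsf{x})$. Let $\Omega\subset\mathbb{R}^n$ be a domain. A harmonic curve (also called $C^2$-harmonic mapping) is a $C^2$ map $f=(\mathsf{x},\mathsf{y},\mathsf{t}):\Omega\to\mathbb{H}^1$, also written $f=(\mathsf{z},\mathsf{t})$ with $\mathsf{z}=\mathsf{x}+i\mathsf{y}$, such that: (1) (isotropicity) $\frac{\partial\mathsf{x}}{\partial x_\alpha}\frac{\partial\mathsf{y}}{\partial x_\beta}-\frac{\partial\mathsf{x}}{\partial x_\beta}\frac{\partial\mathsf{y}}{\partial x_\alpha}=0$ for all $\alpha<\beta$, and the contact condition $f^*\theta=0$ holds, i.e. $\nabla\mathsf{t}=2(\mathsf{y}\nabla\mathsf{x}-\mathsf{x}\nabla\mathsf{y})$; (2) (criticality) $\mathsf{z}$ is a critical point of $E^2(f)=\int_\Omega|\nabla\mathsf{z}|^2dx$,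 where $|\nabla\mathsf{z}|^2=|\nabla\mathsf{x}|^2+|\nabla\mathsf{y}|^2$, with respect to domain variations $\mathsf{z}_s(x)=\mathsf{z}(x+s\xi(x))$, $\xi\in C_0^\infty(\Omega,\mathbb{R}^n)$; that is, for all $\phi\in C_0^\infty(\Omega)$ and $\gamma=1,\dots,n$, $$\int_\Omega\Big(|\nabla\mathsf{z}|^2\frac{\partial\phi}{\partial x_\gamma}-2\sum_{\beta=1}^n\Big(\frac{\partial\mathsf{x}}{\partial x_\beta}\frac{\partial\mathsf{x}}{\partial x_\gamma}+\frac{\partial\mathsf{y}}{\partial x_\beta}\frac{\partial\mathsf{y}}{\partial x_\gamma}\Big)\frac{\partial\phi}{\partial x_\beta}\Big)dx=0.$$ Throughout, $\mathsf{x}=H\circ\mathsf{y}$ for a $C^2$ function $H:I\to\mathbb{R}$ on an interval $I\supset\mathsf{y}(\Omega)$. For such maps, criticality is equivalent to $$\Delta\mathsf{y}=-\frac{(H''\circ\mathsf{y})(H'\circ\mathsf{y})}{1+(H'\circ\mathsf{y})^2}|\nabla\mathsf{y}|^2\quad\text{in }\Omega.$$ *)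

theory Defs
  imports "HOL-Analysis.Analysis"
begin

definition partial_deriv ::
  "'n \<Rightarrow> (real ^ 'n::finite \<Rightarrow> 'b::real_normed_vector) \<Rightarrow> real ^ 'n \<Rightarrow> 'b" where
  "partial_deriv i f p = frechet_derivative f (at p) (axis i 1)"

text \<open>Being of class \<open>C^k\<close>; meant for open \<open>S\<close>, since differentiability is two-sided.\<close>

primrec Ck_on :: "nat \<Rightarrow> (real ^ 'n::finite \<Rightarrow> 'b::real_normed_vector) \<Rightarrow> (real ^ 'n) set \<Rightarrow> bool" where
  "Ck_on 0 f S \<longleftrightarrow> continuous_on S f"
| "Ck_on (Suc k) f S \<longleftrightarrow>
     (\<forall>p\<in>S. f differentiable (at p)) \<and> (\<forall>i. Ck_on k (partial_deriv i f) S)"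

text \<open>Elements of \<open>C_0^\<infinity>(\<Omega>)\<close> are represented by their extension by zero to the whole space.\<close>

definition test_function :: "(real ^ 'n::finite) set \<Rightarrow> (real ^ 'n \<Rightarrow> real) \<Rightarrow> bool" where
  "test_function \<Omega> \<phi> \<longleftrightarrow>
     (\<forall>k. Ck_on k \<phi> UNIV) \<and> compact (closure {p. \<phi> p \<noteq> 0}) \<and> closure {p. \<phi> p \<noteq> 0} \<subseteq> \<Omega>"

text \<open>Points of the Heisenberg group are pairs \<open>(z, t)\<close> with \<open>z = x + i y\<close>.\<close>

type_synonym heis = "complex \<times> real"

text \<open>The form \<open>dt + 2 (x dy - y dx)\<close> at the point \<open>q\<close>, evaluated on the tangent vector \<open>v\<close>.\<close>

definition contact_form :: "heis \<Rightarrow> heis \<Rightarrow> real" where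
  "contact_form q v =
     snd v + 2 * (Re (fst q) * Im (fst v) - Im (fst q) * Re (fst v))"

definition contact_on :: "(real ^ 'n::finite) set \<Rightarrow> (real ^ 'n \<Rightarrow> heis) \<Rightarrow> bool" where
  "contact_on \<Omega> f \<longleftrightarrow>
     (\<forall>p\<in>\<Omega>. \<forall>v. contact_form (f p) (frechet_derivative f (at p) v) = 0)"

text \<open>The index type carries no order. The expression is antisymmetric in \<open>\<alpha>\<close>, \<open>\<beta>\<close>, so
  quantifying over all pairs amounts to quantifying over \<open>\<alpha> < \<beta>\<close>.\<close>

definition isotropic_on :: "(real ^ 'n::finite) set \<Rightarrow> (real ^ 'n \<Rightarrow> complex) \<Rightarrow> bool" where
  "isotropic_on \<Omega> z \<longleftrightarrow>
     (\<forall>p\<in>\<Omega>. \<forall>\<alpha> \<beta>.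
        partial_deriv \<alpha> (\<lambda>q. Re (z q)) p * partial_deriv \<beta> (\<lambda>q. Im (z q)) p
      - partial_deriv \<beta> (\<lambda>q. Re (z q)) p * partial_deriv \<alpha> (\<lambda>q. Im (z q)) p = 0)"

definition energy_density :: "(real ^ 'n::finite \<Rightarrow> complex) \<Rightarrow> real ^ 'n \<Rightarrow> real" where
  "energy_density z p =
     (\<Sum>\<beta>\<in>UNIV. (partial_deriv \<beta> (\<lambda>q. Re (z q)) p)\<^sup>2)
   + (\<Sum>\<beta>\<in>UNIV. (partial_deriv \<beta> (\<lambda>q. Im (z q)) p)\<^sup>2)"

text \<open>Criticality of the energy \<open>\<integral> |\<nabla>z|^2\<close> under domain variations \<open>z(p + s \<xi>(p))\<close>, expressed by
  the vanishing of the first variation: the energy itself may be infinite, whereas the integrand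
  below is continuous with compact support.\<close>

definition critical_on :: "(real ^ 'n::finite) set \<Rightarrow> (real ^ 'n \<Rightarrow> complex) \<Rightarrow> bool" where
  "critical_on \<Omega> z \<longleftrightarrow>
     (\<forall>\<phi> \<gamma>. test_function \<Omega> \<phi> \<longrightarrow>
        (LINT p:\<Omega>|lborel.
           energy_density z p * partial_deriv \<gamma> \<phi> p
         - 2 * (\<Sum>\<beta>\<in>UNIV.
             (partial_deriv \<beta> (\<lambda>q. Re (z q)) p * partial_deriv \<gamma> (\<lambda>q. Re (z q)) p
            + partial_deriv \<beta> (\<lambda>q. Im (z q)) p * partial_deriv \<gamma> (\<lambda>q. Im (z q)) p)
            * partial_deriv \<beta> \<phi> p)) = 0)"

definition harmonic_curve_on :: "(real ^ 'n::finite) set \<Rightarrow> (real ^ 'n \<Rightarrow> heis) \<Rightarrow> bool" where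
  "harmonic_curve_on \<Omega> f \<longleftrightarrow>
     open \<Omega> \<and> connected \<Omega> \<and> \<Omega> \<noteq> {} \<and> Ck_on 2 f \<Omega> \<and>
     isotropic_on \<Omega> (\<lambda>p. fst (f p)) \<and> contact_on \<Omega> f \<and> critical_on \<Omega> (\<lambda>p. fst (f p))"

text \<open>\<open>H\<close> is of class \<open>C^2\<close> on the interval \<open>I\<close>, with first and second derivatives \<open>H'\<close>, \<open>H''\<close>
  (one-sided at endpoints belonging to \<open>I\<close>).\<close>

definition C2_on_interval ::
  "real set \<Rightarrow> (real \<Rightarrow> real) \<Rightarrow> (real \<Rightarrow> real) \<Rightarrow> (real \<Rightarrow> real) \<Rightarrow> bool" where
  "C2_on_interval I H H' H'' \<longleftrightarrow>
     is_interval I \<and>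
     (\<forall>u\<in>I. (H has_real_derivative H' u) (at u within I)) \<and>
     (\<forall>u\<in>I. (H' has_real_derivative H'' u) (at u within I)) \<and>
     continuous_on I H''"

end

theory Submission
  imports Defs
begin

text \<open>Let \<open>G\<close> be an antiderivative of \<open>g = sqrt (1 + H'\<^sup>2)\<close>, the arc length of the curve traced by \<open>z\<close>, and
  put \<open>u = G \<circ> y\<close>. The energy of \<open>z\<close> is the Dirichlet energy of \<open>u\<close>, and criticality under domain
  variations forces \<open>\<Delta>u = 0\<close>. The logarithmic derivative of \<open>g\<close> is \<open>H'' H' / (1 + H'\<^sup>2)\<close>, so the
  hypothesis on the supremum bounds the growth of \<open>g\<close> near finite endpoints of the range of \<open>y\<close> well
  enough to make \<open>G\<close>, and hence \<open>u\<close>, bounded. Liouville's theorem makes \<open>u\<close> constant, so \<open>y\<close> is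
  constant as \<open>g > 0\<close>, and then \<open>t\<close> is constant by the contact condition. Liouville's theorem for
  functions that are merely \<open>C\<^sup>2\<close> follows from comparing \<open>u\<close> with its reflections in coordinate
  hyperplanes on large half balls.\<close>

subsection \<open>Differentiable functions and bump functions\<close>

lemma partial_deriv_eq:
  "(f has_derivative f') (at p) \<Longrightarrow> partial_deriv i f p = f' (axis i 1)"
  unfolding partial_deriv_def by (metis frechet_derivative_at)

lemma has_derivative_frechet: "f differentiable (at p) \<Longrightarrow> (f has_derivative frechet_derivative f (at p)) (at p)"
  by (simp add: frechet_derivative_works)

lemma partial_deriv_bounded_linear:
  assumes "bounded_linear L" "f differentiable (at p)"
  shows "partial_deriv i (\<lambda>q. L (f q)) p = L (partial_deriv i f p)"
  using partial_deriv_eq[OF bounded_linear.has_derivative[OF assms(1) has_derivative_frechet[OF assms(2)]]]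
  by (simp add: partial_deriv_def)

lemma partial_deriv_add:
  assumes "f differentiable (at p)" "g differentiable (at p)"
  shows "partial_deriv i (\<lambda>q. f q + g q) p = partial_deriv i f p + partial_deriv i g p"
  using partial_deriv_eq[OF has_derivative_add[OF assms[THEN has_derivative_frechet]]]
  by (simp add: partial_deriv_def)

lemma partial_deriv_mult:
  fixes f g :: "real ^ 'n::finite \<Rightarrow> real"
  assumes "f differentiable (at p)" "g differentiable (at p)"
  shows "partial_deriv i (\<lambda>q. f q * g q) p = f p * partial_deriv i g p + partial_deriv i f p * g p"
  using partial_deriv_eq[OF has_derivative_mult[OF assms[THEN has_derivative_frechet]]]
  by (simp add: partial_deriv_def)

text \<open>The outer function is differentiated only within the range of \<open>f\<close>, because
  \<open>H\<close> and the antiderivative \<open>G\<close> live on an interval and may have merely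
  one-sided derivatives at an endpoint that \<open>y\<close> attains.\<close>

lemma partial_deriv_compose_real:
  fixes f :: "real ^ 'n::finite \<Rightarrow> real"
  assumes "f differentiable (at p)" "(h has_real_derivative d) (at (f p) within range f)"
  shows "(\<lambda>q. h (f q)) differentiable (at p)"
    and "partial_deriv i (\<lambda>q. h (f q)) p = d * partial_deriv i f p"
proof -
  have "((\<lambda>q. h (f q)) has_derivative (\<lambda>v. frechet_derivative f (at p) v * d)) (at p)"
    using has_derivative_in_compose[OF has_derivative_frechet[OF assms(1)], of h "\<lambda>v. v * d"] assms(2)
    by (simp add: has_field_derivative_def mult_commute_abs)
  then show "(\<lambda>q. h (f q)) differentiable (at p)"
    and "partial_deriv i (\<lambda>q. h (f q)) p = d * partial_deriv i f p"
    by (auto simp: differentiable_def partial_deriv_eq) (simp add: partial_deriv_def)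
qed

section \<open>Closure properties of the classes \<open>Ck_on k\<close> on the whole space\<close>

lemma Ck_on_SucI:
  assumes "\<And>p. f differentiable (at p)" "\<And>i p. partial_deriv i f p = D i p" "\<And>i. Ck_on k (D i) UNIV"
  shows "Ck_on (Suc k) f UNIV"
proof -
  have "partial_deriv i f = D i" for i using assms(2) by blast
  with assms show ?thesis by simp
qed

lemma Ck_on_SucD: "Ck_on (Suc k) f UNIV \<Longrightarrow> Ck_on k f UNIV"
proof (induction k arbitrary: f)
  case 0
  then show ?case
    by (auto intro!: differentiable_imp_continuous_on simp: differentiable_on_def)
next
  case (Suc k)
  then show ?case by auto
qed

lemma Ck_on_continuous: "Ck_on k f UNIV \<Longrightarrow> continuous_on UNIV f"
proof (induction k)
  case (Suc k)
  from Suc.IH[OF Ck_on_SucD[OF Suc.prems]] show ?case .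
qed simp

lemma Ck_on_Suc_UNIV:
  "Ck_on (Suc k) f UNIV \<longleftrightarrow> (\<forall>p. f differentiable (at p)) \<and> (\<forall>i. Ck_on k (partial_deriv i f) UNIV)"
  unfolding Ck_on.simps(2) ball_UNIV ..

lemma Ck_on_1D:
  assumes "Ck_on 1 f UNIV"
  shows "f differentiable (at p)" and "continuous_on UNIV (partial_deriv i f)"
proof -
  have f: "Ck_on (Suc 0) f UNIV"
    using assms unfolding One_nat_def .
  show "f differentiable (at p)"
    using f[unfolded Ck_on_Suc_UNIV, THEN conjunct1] by (rule spec)
  have "Ck_on 0 (partial_deriv i f) UNIV"
    using f[unfolded Ck_on_Suc_UNIV, THEN conjunct2] by (rule spec)
  then show "continuous_on UNIV (partial_deriv i f)"
    by (rule Ck_on_continuous)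
qed

lemma Ck_on_2D:
  assumes "Ck_on 2 f UNIV"
  shows "f differentiable (at p)" and "Ck_on 1 (partial_deriv i f) UNIV"
proof -
  have f: "Ck_on (Suc 1) f UNIV"
    using assms by (subst Suc_1)
  show "f differentiable (at p)"
    using f[unfolded Ck_on_Suc_UNIV[of 1], THEN conjunct1] by (rule spec)
  show "Ck_on 1 (partial_deriv i f) UNIV"
    using f[unfolded Ck_on_Suc_UNIV[of 1], THEN conjunct2] by (rule spec)
qed

lemma Ck_on_bounded_linear:
  assumes "bounded_linear L"
  shows "Ck_on k f UNIV \<Longrightarrow> Ck_on k (\<lambda>q. L (f q)) UNIV"
proof (induction k arbitrary: f)
  case 0
  then show ?case
    using assms by (auto intro: bounded_linear.continuous_on)
next
  case (Suc k)
  then have f: "f differentiable (at p)" for p by simp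
  show ?case
    by (rule Ck_on_SucI[where D = "\<lambda>i q. L (partial_deriv i f q)"])
      (use Suc differentiableI[OF bounded_linear.has_derivative[OF assms has_derivative_frechet[OF f]]] in
        \<open>simp_all add: partial_deriv_bounded_linear[OF assms]\<close>)
qed

lemma Ck_on_const: "Ck_on k (\<lambda>_. c) UNIV"
proof (induction k arbitrary: c)
  case (Suc k)
  show ?case
    by (rule Ck_on_SucI[where D = "\<lambda>i q. 0"]) (auto intro: Suc simp: partial_deriv_def)
qed auto

lemma Ck_on_add:
  "Ck_on k f UNIV \<Longrightarrow> Ck_on k g UNIV \<Longrightarrow> Ck_on k (\<lambda>q. f q + g q) UNIV"
proof (induction k arbitrary: f g)
  case (Suc k)
  show ?case
    by (rule Ck_on_SucI[where D = "\<lambda>i q. partial_deriv i f q + partial_deriv i g q"])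
      (use Suc in \<open>auto simp: partial_deriv_add\<close>)
qed (auto intro: continuous_intros)

lemma Ck_on_mult:
  fixes f g :: "real ^ 'n::finite \<Rightarrow> real"
  shows "Ck_on k f UNIV \<Longrightarrow> Ck_on k g UNIV \<Longrightarrow> Ck_on k (\<lambda>q. f q * g q) UNIV"
proof (induction k arbitrary: f g)
  case (Suc k)
  show ?case
    by (rule Ck_on_SucI[where D = "\<lambda>i q. f q * partial_deriv i g q + partial_deriv i f q * g q"])
      (use Suc Ck_on_SucD in \<open>auto simp: partial_deriv_mult intro!: Ck_on_add Suc.IH\<close>)
qed (auto intro: continuous_intros)

lemma Ck_on_nth: "Ck_on k (\<lambda>q. q $ i) UNIV"
proof (cases k)
  case (Suc k')
  have "((\<lambda>q. q $ i) has_derivative (\<lambda>q. q $ i)) (at p)" for p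
    by (simp add: bounded_linear_imp_has_derivative bounded_linear_vec_nth)
  then have "(\<lambda>q. q $ i) differentiable (at p)" "partial_deriv j (\<lambda>q. q $ i) p = axis j 1 $ i" for p j
    by (blast intro: differentiableI, rule partial_deriv_eq)
  then show ?thesis
    unfolding Suc by (intro Ck_on_SucI) (auto intro: Ck_on_const)
qed (auto intro: continuous_intros)

section \<open>Smooth bump functions\<close>

text \<open>The powers of \<open>1 / s\<close> make this family of functions closed under differentiation.\<close>

definition flat_exp :: "nat \<Rightarrow> real \<Rightarrow> real" where
  "flat_exp m s = (if s > 0 then inverse s ^ m * exp (- inverse s) else 0)"

lemma flat_exp_tendsto_0: "(flat_exp m \<longlongrightarrow> 0) (at 0)"
  unfolding filterlim_at_split
proof
  show "(flat_exp m \<longlongrightarrow> 0) (at_left 0)"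
    by (rule tendsto_eventually) (auto simp: eventually_at flat_exp_def intro!: exI[of _ 1])
  have "((\<lambda>s::real. inverse s ^ m / exp (inverse s)) \<longlongrightarrow> 0) (at_right 0)"
    by (rule filterlim_compose[OF tendsto_power_div_exp_0 filterlim_inverse_at_top_right])
  moreover have "\<forall>\<^sub>F s in at_right 0. inverse s ^ m / exp (inverse s) = flat_exp m s"
    by (auto simp: eventually_at flat_exp_def exp_minus field_simps intro!: exI[of _ 1])
  ultimately show "(flat_exp m \<longlongrightarrow> 0) (at_right 0)"
    by (rule Lim_transform_eventually)
qed

lemma flat_exp_has_derivative:
  "(flat_exp m has_real_derivative (flat_exp (Suc (Suc m)) s - real m * flat_exp (Suc m) s)) (at s)"
proof (cases s "0::real" rule: linorder_cases)
  case less
  have "((\<lambda>_. 0) has_real_derivative 0) (at s)" by simp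
  then have "(flat_exp m has_real_derivative 0) (at s)"
    by (rule has_field_derivative_transform_within_open[where S = "{..<0}"])
      (use less in \<open>auto simp: flat_exp_def\<close>)
  then show ?thesis using less by (simp add: flat_exp_def)
next
  case equal
  \<comment> \<open>The difference quotient at 0 is the next member of the family. This holds at
    \<open>h = 0\<close> too, where division by zero yields 0.\<close>
  have "(\<lambda>h. (flat_exp m (0 + h) - flat_exp m 0) / h) = flat_exp (Suc m)"
    by (auto simp: flat_exp_def fun_eq_iff field_simps)
  then have "(flat_exp m has_real_derivative 0) (at 0)"
    unfolding DERIV_def using flat_exp_tendsto_0 by simp
  then show ?thesis using equal by (simp add: flat_exp_def)
next
  case greater
  define r e where "r = inverse s" and "e = exp (- inverse s)"
  have inv: "(inverse has_real_derivative - (r * r)) (at s)"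
    using DERIV_inverse[of s UNIV] greater by (simp add: r_def)
  have "((\<lambda>s. inverse s ^ m * exp (- inverse s)) has_real_derivative
      (real m * (- (r * r) * r ^ (m - Suc 0)) * e + e * - (- (r * r)) * r ^ m)) (at s)"
    unfolding r_def e_def
    by (rule DERIV_mult[OF DERIV_power[OF inv] DERIV_fun_exp[OF DERIV_minus[OF inv]], unfolded r_def])
  \<comment> \<open>The truncated exponent \<open>m - Suc 0\<close> is wrong only for
    \<open>m = 0\<close>, where the factor \<open>real m\<close> removes the term; hence the case
    split on \<open>m\<close>.\<close>
  moreover have "real m * (- (r * r) * r ^ (m - Suc 0)) * e + e * - (- (r * r)) * r ^ m
      = r ^ Suc (Suc m) * e - real m * (r ^ Suc m * e)"
    by (cases m) (simp_all add: algebra_simps)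
  ultimately have "((\<lambda>s. inverse s ^ m * exp (- inverse s)) has_real_derivative
      (flat_exp (Suc (Suc m)) s - real m * flat_exp (Suc m) s)) (at s)"
    using greater unfolding r_def e_def by (simp only: flat_exp_def if_True)
  then show ?thesis
    by (rule has_field_derivative_transform_within_open[where S = "{0<..}"])
      (use greater in \<open>auto simp: flat_exp_def\<close>)
qed

lemma Ck_on_flat_exp_compose:
  fixes \<rho> :: "real ^ 'n::finite \<Rightarrow> real"
  assumes "\<And>k. Ck_on k \<rho> UNIV"
  shows "Ck_on k (\<lambda>q. flat_exp m (\<rho> q)) UNIV"
proof (induction k arbitrary: m)
  case 0
  have "continuous_on UNIV (flat_exp m)"
    using DERIV_isCont[OF flat_exp_has_derivative] by (simp add: continuous_on_eq_continuous_at)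
  then show ?case
    using continuous_on_compose2[OF _ Ck_on_continuous[OF assms[of 0]], of UNIV "flat_exp m"] by simp
next
  case (Suc k)
  have \<rho>: "\<rho> differentiable (at p)" for p
    using assms[of "Suc 0"] by simp
  have \<rho>': "Ck_on k (partial_deriv i \<rho>) UNIV" for i
    using assms[of "Suc k"] by simp
  note d = has_field_derivative_at_within[OF flat_exp_has_derivative]
  have "Ck_on k (\<lambda>q. (flat_exp (Suc (Suc m)) (\<rho> q) + (- real m) * flat_exp (Suc m) (\<rho> q)) * partial_deriv i \<rho> q) UNIV" for i
    by (intro Ck_on_mult Ck_on_add Suc \<rho>' Ck_on_const)
  then show ?case
    by (intro Ck_on_SucI[OF partial_deriv_compose_real[OF \<rho> d]]) simp
qed

lemma bump_function_exists:
  fixes p :: "real ^ 'n::finite"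
  assumes "r > 0"
  obtains \<phi> where "test_function UNIV \<phi>" "\<And>q. \<phi> q \<ge> 0" "\<And>q. \<phi> q > 0 \<longleftrightarrow> q \<in> ball p r"
proof -
  \<comment> \<open>This is \<open>r\<^sup>2\<close> minus the squared distance from
    \<open>p\<close>, spelled out with sums and products of coordinates only, so that the closure
    properties of \<open>Ck_on\<close> apply literally. It is positive exactly on the ball.\<close>
  define \<rho> where "\<rho> q = r\<^sup>2 + (\<Sum>i\<in>UNIV. (-1) * ((q $ i + - p $ i) * (q $ i + - p $ i)))" for q
  define \<phi> where "\<phi> q = flat_exp 0 (\<rho> q)" for q
  have sum: "finite A \<Longrightarrow> Ck_on k (\<lambda>q. \<Sum>i\<in>A. (-1) * ((q $ i + - p $ i) * (q $ i + - p $ i))) UNIV" for k A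
    by (induction rule: finite_induct)
      (simp_all only: sum.empty sum.insert not_False_eq_True Ck_on_add Ck_on_mult Ck_on_const Ck_on_nth)
  have smooth: "Ck_on k \<phi> UNIV" for k
    unfolding \<phi>_def by (rule Ck_on_flat_exp_compose) (simp only: \<rho>_def Ck_on_add Ck_on_const sum finite)
  have \<rho>: "\<rho> q = r\<^sup>2 - (norm (p - q))\<^sup>2" for q
    unfolding norm_minus_commute[of p q] \<rho>_def power2_norm_eq_inner by (simp add: inner_vec_def sum_negf)
  have "(norm (p - q))\<^sup>2 < r\<^sup>2 \<longleftrightarrow> norm (p - q) < r" for q
    using assms power2_less_imp_less[of "norm (p - q)" r] power_strict_mono[of "norm (p - q)" r 2]
    by (metis less_imp_le norm_ge_zero pos2)
  then have pos: "\<phi> q > 0 \<longleftrightarrow> q \<in> ball p r" for q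
    unfolding \<phi>_def flat_exp_def \<rho> by (simp add: dist_norm)
  have nn: "\<phi> q \<ge> 0" for q by (auto simp: \<phi>_def flat_exp_def)
  have "{q. \<phi> q \<noteq> 0} = ball p r" using pos nn by (auto simp: less_le)
  then have "test_function UNIV \<phi>"
    using smooth unfolding test_function_def by simp
  with that pos nn show ?thesis by blast
qed

subsection \<open>Integration by parts\<close>

text \<open>The speed \<open>a\<close> is there for reflected lines: the mirror image of a point
  moving along the reflected axis runs backwards, which is the case \<open>a = - 1\<close>.\<close>

lemma has_real_derivative_along_axis:
  fixes f :: "real ^ 'n::finite \<Rightarrow> real"
  assumes "f differentiable (at (p + (a * s) *\<^sub>R axis i 1))"
  shows "((\<lambda>s. f (p + (a * s) *\<^sub>R axis i 1)) has_real_derivative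
    a * partial_deriv i f (p + (a * s) *\<^sub>R axis i 1)) (at s)"
proof -
  let ?q = "p + (a * s) *\<^sub>R axis i (1::real)"
  let ?D = "frechet_derivative f (at ?q)"
  have f': "(f has_derivative ?D) (at ?q)"
    by (rule has_derivative_frechet[OF assms])
  have "((\<lambda>s. p + (a * s) *\<^sub>R axis i 1) has_derivative (\<lambda>h. (a * h) *\<^sub>R axis i 1)) (at s)"
    by (auto intro!: derivative_eq_intros)
  from has_derivative_compose[OF this f']
  have "((\<lambda>s. f (p + (a * s) *\<^sub>R axis i 1)) has_derivative (\<lambda>h. ?D ((a * h) *\<^sub>R axis i 1))) (at s)" .
  moreover have "?D ((a * h) *\<^sub>R axis i 1) = a * partial_deriv i f ?q * h" for h
    using linear_cmul[OF has_derivative_linear[OF f']] by (simp add: partial_deriv_def)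
  ultimately show ?thesis
    by (simp only: has_field_derivative_def)
qed

lemma mvt_along_axis:
  fixes f :: "real ^ 'n::finite \<Rightarrow> real"
  assumes "\<And>p. f differentiable (at p)" "h > 0"
  obtains s where "0 < s" "s < h"
    "f (p + h *\<^sub>R axis i 1) - f p = h * partial_deriv i f (p + s *\<^sub>R axis i 1)"
proof -
  have d: "((\<lambda>s. f (p + s *\<^sub>R axis i 1)) has_real_derivative partial_deriv i f (p + s *\<^sub>R axis i 1)) (at s)" for s
    using has_real_derivative_along_axis[where a = 1, of f p s i] assms by simp
  from MVT2[OF assms(2) d] obtain s where "0 < s" "s < h"
    "f (p + h *\<^sub>R axis i 1) - f (p + 0 *\<^sub>R axis i 1) = (h - 0) * partial_deriv i f (p + s *\<^sub>R axis i 1)"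
    by blast
  with that show ?thesis by simp
qed

text \<open>Both mixed derivatives are limits of the second difference over a small square.\<close>

lemma partial_deriv_commute:
  fixes u :: "real ^ 'n::finite \<Rightarrow> real"
  assumes u: "Ck_on 2 u UNIV"
  shows "partial_deriv i (partial_deriv j u) p = partial_deriv j (partial_deriv i u) p"
proof -
  define e :: "'n \<Rightarrow> real ^ 'n" where "e k = axis k 1" for k
  define S where "S i j h = u (p + h *\<^sub>R e i + h *\<^sub>R e j) - u (p + h *\<^sub>R e i) - u (p + h *\<^sub>R e j) + u p" for i j h
  have d1: "u differentiable (at q)" and d2: "partial_deriv k u differentiable (at q)" for k q
    using Ck_on_2D(1)[OF u] Ck_on_1D(1)[OF Ck_on_2D(2)[OF u]] by blast+
  \<comment> \<open>Two mean value theorems: one in direction \<open>i\<close> for the increment of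
    \<open>u\<close> over the step \<open>h\<close> in direction \<open>j\<close>, then one in
    direction \<open>j\<close> for \<open>partial_deriv i u\<close>.\<close>
  have key: "\<exists>q. dist q p < 2 * h \<and> S i j h = h * h * partial_deriv j (partial_deriv i u) q"
    if h: "h > 0" for i j h
  proof -
    have "((\<lambda>s. u ((p + h *\<^sub>R e j) + s *\<^sub>R e i) - u (p + s *\<^sub>R e i)) has_real_derivative
      partial_deriv i u ((p + h *\<^sub>R e j) + s *\<^sub>R e i) - partial_deriv i u (p + s *\<^sub>R e i)) (at s)" for s
      using has_real_derivative_along_axis[where a = 1 and s = s and i = i, OF d1] by (intro DERIV_diff) (simp_all add: e_def)
    from MVT2[OF h this] obtain s where s: "0 < s" "s < h" and
      "(u ((p + h *\<^sub>R e j) + h *\<^sub>R e i) - u (p + h *\<^sub>R e i)) - (u ((p + h *\<^sub>R e j) + 0 *\<^sub>R e i) - u (p + 0 *\<^sub>R e i))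
        = (h - 0) * (partial_deriv i u ((p + h *\<^sub>R e j) + s *\<^sub>R e i) - partial_deriv i u (p + s *\<^sub>R e i))"
      by blast
    then have "S i j h = h * (partial_deriv i u ((p + s *\<^sub>R e i) + h *\<^sub>R e j) - partial_deriv i u (p + s *\<^sub>R e i))"
      by (simp add: S_def ac_simps)
    moreover obtain r where r: "0 < r" "r < h" and
      "partial_deriv i u ((p + s *\<^sub>R e i) + h *\<^sub>R e j) - partial_deriv i u (p + s *\<^sub>R e i)
        = h * partial_deriv j (partial_deriv i u) (p + s *\<^sub>R e i + r *\<^sub>R e j)"
      using mvt_along_axis[OF d2 h, of i "p + s *\<^sub>R e i" j] unfolding e_def by blast
    ultimately have "S i j h = h * h * partial_deriv j (partial_deriv i u) (p + s *\<^sub>R e i + r *\<^sub>R e j)"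
      by simp
    moreover have "dist (p + s *\<^sub>R e i + r *\<^sub>R e j) p \<le> norm (s *\<^sub>R e i) + norm (r *\<^sub>R e j)"
      using norm_triangle_ineq[of "s *\<^sub>R e i" "r *\<^sub>R e j"] by (simp add: dist_norm add.assoc)
    ultimately show ?thesis
      using s r by (intro exI[of _ "p + s *\<^sub>R e i + r *\<^sub>R e j"]) (auto simp: e_def)
  qed
  have lim: "\<exists>q. (q \<longlonglongrightarrow> p) \<and> (\<forall>n. S i j (1 / Suc n) * (real (Suc n))\<^sup>2 = partial_deriv j (partial_deriv i u) (q n))" for i j
  proof -
    have "\<forall>n. \<exists>q. dist q p < 2 * (1 / Suc n) \<and> S i j (1 / Suc n) = (1 / Suc n) * (1 / Suc n) * partial_deriv j (partial_deriv i u) q"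
      by (intro allI key) simp
    then obtain q where q: "\<And>n. dist (q n) p < 2 * (1 / Suc n)"
      "\<And>n. S i j (1 / Suc n) = (1 / Suc n) * (1 / Suc n) * partial_deriv j (partial_deriv i u) (q n)"
      by metis
    have "(\<lambda>n. 2 * (1 / Suc n)) \<longlonglongrightarrow> 2 * 0"
      by (rule tendsto_mult_left[OF LIMSEQ_Suc[OF lim_1_over_n]])
    then have "(\<lambda>n. 2 * (1 / Suc n)) \<longlonglongrightarrow> 0" by simp
    then have "(\<lambda>n. dist (q n) p) \<longlonglongrightarrow> 0"
      by (rule Lim_null_comparison[rotated]) (intro always_eventually allI, use q(1) in \<open>simp only: real_norm_def abs_of_nonneg zero_le_dist less_imp_le\<close>)
    then have "q \<longlonglongrightarrow> p" by (rule tendsto_dist_iff[THEN iffD2])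
    moreover have "S i j (1 / Suc n) * (real (Suc n))\<^sup>2 = partial_deriv j (partial_deriv i u) (q n)" for n
      unfolding q(2) power2_eq_square by (simp add: divide_simps del: of_nat_Suc)
    ultimately show ?thesis by blast
  qed
  have cont: "isCont (partial_deriv j (partial_deriv i u)) p" for i j
    using Ck_on_1D(2)[OF Ck_on_2D(2)[OF u]] by (simp add: continuous_on_eq_continuous_at)
  have "(\<lambda>n. S i j (1 / Suc n) * (real (Suc n))\<^sup>2) \<longlonglongrightarrow> partial_deriv j (partial_deriv i u) p" for i j
  proof -
    obtain q where "q \<longlonglongrightarrow> p" and
      q: "\<And>n. S i j (1 / Suc n) * (real (Suc n))\<^sup>2 = partial_deriv j (partial_deriv i u) (q n)"
      using lim[of i j] by blast
    then show ?thesis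
      unfolding q by (intro isCont_tendsto_compose[OF cont])
  qed
  \<comment> \<open>\<open>S\<close> is symmetric in its two directions, so both limits belong to
    the same sequence.\<close>
  from this[of i j] this[of j i] have
    "(\<lambda>n. S i j (1 / Suc n) * (real (Suc n))\<^sup>2) \<longlonglongrightarrow> partial_deriv j (partial_deriv i u) p"
    "(\<lambda>n. S i j (1 / Suc n) * (real (Suc n))\<^sup>2) \<longlonglongrightarrow> partial_deriv i (partial_deriv j u) p"
    unfolding S_def by (simp_all only: add.assoc add.commute[of "_ *\<^sub>R e j"] diff_diff_eq add.commute[of "u (p + _ *\<^sub>R e j)"])
  then show ?thesis
    by (rule LIMSEQ_unique[rotated])
qed

section \<open>Integrals of derivatives and the fundamental lemma of the calculus of
  variations\<close>

lemma lborel_integral_translate: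
  fixes f :: "'a::euclidean_space \<Rightarrow> real"
  assumes "f \<in> borel_measurable borel"
  shows "(LINT x|lborel. f (c + x)) = (LINT x|lborel. f x)"
    and "integrable lborel (\<lambda>x. f (c + x)) \<longleftrightarrow> integrable lborel f"
  using integral_distr[of "(+) c" lborel borel f] integrable_distr_eq[of "(+) c" lborel borel f] assms
  by (simp_all add: lborel_distr_plus)

lemma integrable_continuous_bounded_support:
  fixes f :: "'a::euclidean_space \<Rightarrow> real"
  assumes "continuous_on UNIV f" "\<And>x. norm x > R \<Longrightarrow> f x = 0"
  shows "integrable lborel f"
proof -
  have "integrable lborel (\<lambda>x. indicator (cball 0 R) x *\<^sub>R f x)"
    using assms(1) by (intro borel_integrable_compact) (auto intro: continuous_on_subset)
  moreover have "(\<lambda>x. indicator (cball 0 R) x *\<^sub>R f x) = f"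
    using assms(2) by (auto simp: indicator_def fun_eq_iff not_le)
  ultimately show ?thesis by simp
qed

text \<open>Difference quotients have integral zero by translation invariance, and they converge
  dominatedly.\<close>

lemma integral_partial_deriv_eq_0:
  fixes \<psi> :: "real ^ 'n::finite \<Rightarrow> real"
  assumes \<psi>: "Ck_on 1 \<psi> UNIV" and supp: "\<And>x. norm x > R \<Longrightarrow> \<psi> x = 0"
  shows "integrable lborel (partial_deriv i \<psi>)" "(LINT x|lborel. partial_deriv i \<psi> x) = 0"
proof -
  define e :: "real ^ 'n" where "e = axis i 1"
  define h where "h n = 1 / real (Suc n)" for n
  define s where "s n x = (\<psi> (h n *\<^sub>R e + x) - \<psi> x) / h n" for n x
  have h: "0 < h n" "h n \<le> 1" for n by (auto simp: h_def)
  have d: "\<psi> differentiable (at x)" for x using Ck_on_1D(1)[OF \<psi>] .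
  have cont: "continuous_on UNIV \<psi>" "continuous_on UNIV (partial_deriv i \<psi>)"
    using Ck_on_continuous[OF \<psi>] Ck_on_1D(2)[OF \<psi>] by blast+
  have [measurable]: "\<psi> \<in> borel_measurable borel" "partial_deriv i \<psi> \<in> borel_measurable borel"
    using cont by (auto intro: borel_measurable_continuous_onI)
  have "compact (partial_deriv i \<psi> ` cball 0 (R + 2))"
    using cont by (intro compact_continuous_image) (auto intro: continuous_on_subset)
  then have "bounded (partial_deriv i \<psi> ` cball 0 (R + 2))"
    by (rule compact_imp_bounded)
  then obtain C where C: "\<And>x. norm x \<le> R + 2 \<Longrightarrow> \<bar>partial_deriv i \<psi> x\<bar> \<le> C"
    unfolding bounded_iff by (metis imageI mem_cball_0 real_norm_def)
  have lim: "(\<lambda>n. s n x) \<longlonglongrightarrow> partial_deriv i \<psi> x" for x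
  proof -
    have "((\<lambda>t. \<psi> (x + t *\<^sub>R e)) has_real_derivative partial_deriv i \<psi> x) (at 0)"
      using has_real_derivative_along_axis[where a = 1 and s = 0, of \<psi> x i] d by (simp add: e_def)
    then have "((\<lambda>t. (\<psi> (x + t *\<^sub>R e) - \<psi> x) / t) \<longlongrightarrow> partial_deriv i \<psi> x) (at 0)"
      by (simp add: DERIV_def)
    moreover have "h \<longlonglongrightarrow> 0"
      unfolding h_def by (rule LIMSEQ_Suc[OF lim_1_over_n])
    then have "filterlim h (at 0) sequentially"
      using h by (auto simp: filterlim_at intro!: always_eventually) (metis less_irrefl)
    ultimately have "((\<lambda>n. (\<psi> (x + h n *\<^sub>R e) - \<psi> x) / h n) \<longlonglongrightarrow> partial_deriv i \<psi> x)"
      by (rule filterlim_compose)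
    then show ?thesis by (simp add: s_def add.commute)
  qed
  \<comment> \<open>As \<open>h n \<le> 1\<close>, the quotient vanishes beyond radius
    \<open>R + 1\<close>. Within that radius the mean value point lies in the ball of radius
    \<open>R + 2\<close>, on which \<open>C\<close> bounds the derivative.\<close>
  have bound: "norm (s n x) \<le> indicator (cball 0 (R + 1)) x *\<^sub>R C" for n x
  proof (cases "norm x \<le> R + 1")
    case True
    obtain t where t: "0 < t" "t < h n" "\<psi> (x + h n *\<^sub>R e) - \<psi> x = h n * partial_deriv i \<psi> (x + t *\<^sub>R e)"
      using mvt_along_axis[OF d h(1), of n x i] unfolding e_def by blast
    have "norm (x + t *\<^sub>R e) \<le> R + 2"
      using norm_triangle_ineq[of x "t *\<^sub>R e"] t h(2)[of n] True by (simp add: e_def)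
    from C[OF this] t h(1)[of n] True show ?thesis
      by (simp add: s_def add.commute)
  next
    case False
    have "norm (h n *\<^sub>R e + x) > R"
      using norm_diff_ineq[of x "h n *\<^sub>R e"] h[of n] False by (simp add: e_def add.commute)
    with False show ?thesis by (simp add: s_def supp)
  qed
  have int: "integrable lborel (\<lambda>x::real ^ 'n. indicator (cball 0 (R + 1)) x *\<^sub>R C)"
    by (intro borel_integrable_compact) auto
  have sm: "s n \<in> borel_measurable lborel" for n
    unfolding s_def by measurable
  have \<psi>int: "integrable lborel \<psi>"
    using integrable_continuous_bounded_support[OF cont(1) supp] .
  have "(LINT x|lborel. s n x) = 0" for n
  proof -
    have "(LINT x|lborel. \<psi> (h n *\<^sub>R e + x) - \<psi> x) = 0"
      using \<psi>int by (subst Bochner_Integration.integral_diff) (simp_all add: lborel_integral_translate)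
    then show ?thesis by (simp add: s_def)
  qed
  moreover have "(\<lambda>n. LINT x|lborel. s n x) \<longlonglongrightarrow> (LINT x|lborel. partial_deriv i \<psi> x)"
    by (rule integral_dominated_convergence[OF _ sm int AE_I2[OF lim] AE_I2[OF bound]]) simp
  ultimately show "(LINT x|lborel. partial_deriv i \<psi> x) = 0"
    by (simp add: LIMSEQ_const_iff)
  show "integrable lborel (partial_deriv i \<psi>)"
    by (rule integrable_dominated_convergence[OF _ sm int AE_I2[OF lim] AE_I2[OF bound]]) simp
qed

lemma test_function_bounded_support:
  assumes "test_function UNIV \<phi>"
  obtains R where "\<And>x. norm x > R \<Longrightarrow> \<phi> x = 0"
proof -
  have "bounded (closure {p. \<phi> p \<noteq> 0})"
    using assms compact_imp_bounded by (auto simp: test_function_def)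
  then obtain R where R: "\<forall>x\<in>closure {p. \<phi> p \<noteq> 0}. norm x \<le> R"
    unfolding bounded_iff by (rule exE)
  have "norm x \<le> R" if "\<phi> x \<noteq> 0" for x
    using R[rule_format, OF subsetD[OF closure_subset]] that by simp
  then have "\<phi> x = 0" if "norm x > R" for x
    using that by (meson not_le)
  then show ?thesis
    by (rule that)
qed

text \<open>If \<open>F p\<close> were nonzero, \<open>F\<close> would keep its sign on a ball
  around \<open>p\<close>. Testing with a bump function of that ball gives a nonnegative integrand
  with integral zero, positive on the whole ball, so the ball would be a null set.\<close>

lemma fundamental_lemma_calculus_of_variations:
  fixes F :: "real ^ 'n::finite \<Rightarrow> real"
  assumes F: "continuous_on UNIV F"
    and zero: "\<And>\<phi>. test_function UNIV \<phi> \<Longrightarrow> (LINT x|lborel. \<phi> x * F x) = 0"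
  shows "F p = 0"
proof (rule ccontr)
  assume "F p \<noteq> 0"
  define \<sigma> where "\<sigma> = sgn (F p)"
  have \<sigma>: "\<sigma> * F p > 0"
    using \<open>F p \<noteq> 0\<close> by (simp add: \<sigma>_def sgn_if)
  have "open {x. \<sigma> * F x > 0}"
    using F by (intro open_Collect_less continuous_intros)
  then obtain r where r: "r > 0" "ball p r \<subseteq> {x. \<sigma> * F x > 0}"
    using \<sigma> by (auto simp: open_contains_ball)
  obtain \<phi> where \<phi>: "test_function UNIV \<phi>" "\<And>q. \<phi> q \<ge> 0" "\<And>q. \<phi> q > 0 \<longleftrightarrow> q \<in> ball p r"
    using bump_function_exists[OF r(1)] by blast
  obtain R where R: "\<And>x. norm x > R \<Longrightarrow> \<phi> x = 0"
    using test_function_bounded_support[OF \<phi>(1)] by blast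
  have c\<phi>: "continuous_on UNIV \<phi>"
    using \<phi>(1) unfolding test_function_def by (intro Ck_on_continuous[of 0]) simp
  have pos: "\<phi> x * (\<sigma> * F x) > 0" if "x \<in> ball p r" for x
    using that r \<phi>(3) by auto
  have nonneg: "\<phi> x * (\<sigma> * F x) \<ge> 0" for x
    using pos[of x] \<phi>(2)[of x] \<phi>(3)[of x] by (cases "x \<in> ball p r") simp_all
  have "integrable lborel (\<lambda>x. \<phi> x * (\<sigma> * F x))"
    by (rule integrable_continuous_bounded_support) (use F c\<phi> R in \<open>auto intro!: continuous_intros\<close>)
  moreover have "(LINT x|lborel. \<phi> x * (\<sigma> * F x)) = 0"
    using zero[OF \<phi>(1)] unfolding mult.left_commute[of _ \<sigma>] by simp
  ultimately have "AE x in lborel. \<phi> x * (\<sigma> * F x) = 0"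
    using nonneg by (subst (asm) integral_nonneg_eq_0_iff_AE) auto
  then have "AE x in lborel. x \<notin> ball p r"
    by (rule AE_mp) (use pos in \<open>force intro!: AE_I2\<close>)
  then have "negligible (ball p r)"
    using AE_iff_null_sets[of "ball p r" lborel] by (simp add: negligible_iff_null_sets null_sets_completionI)
  then show False
    using open_not_negligible[of "ball p r"] r by simp
qed

subsection \<open>Liouville's theorem\<close>

text \<open>If \<open>d\<close> were positive, then \<open>\<phi>'\<close>, which vanishes at 0,
  would be positive just to the right of 0, and \<open>\<phi>\<close> would rise above its value at
  0. Only differentiability of \<open>\<phi>'\<close> at 0 enters, which suits functions that are
  merely twice differentiable.\<close>

lemma second_derivative_nonpos_at_local_max:
  fixes \<phi> :: "real \<Rightarrow> real"
  assumes d1: "\<And>s. (\<phi> has_real_derivative \<phi>' s) (at s)" and d2: "(\<phi>' has_real_derivative d) (at 0)"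
    and \<delta>: "\<delta> > 0" "\<And>s. \<bar>s\<bar> < \<delta> \<Longrightarrow> \<phi> s \<le> \<phi> 0"
  shows "d \<le> 0"
proof (rule ccontr)
  assume "\<not> d \<le> 0"
  have "\<phi>' 0 = 0"
    using DERIV_local_max[OF d1 \<delta>(1), of 0] \<delta>(2) by simp
  then obtain \<eta> where \<eta>: "\<eta> > 0" "\<And>h. 0 < h \<Longrightarrow> h < \<eta> \<Longrightarrow> \<phi>' h > 0"
    using DERIV_pos_inc_right[OF d2] \<open>\<not> d \<le> 0\<close> by auto
  define h where "h = min \<delta> \<eta> / 2"
  have h: "0 < h" "h < \<delta>" "h < \<eta>"
    using \<delta>(1) \<eta>(1) by (auto simp: h_def)
  from MVT2[OF h(1) d1] obtain z where z: "0 < z" "z < h" "\<phi> h - \<phi> 0 = (h - 0) * \<phi>' z"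
    by blast
  then have "\<phi> h - \<phi> 0 > 0"
    using \<eta>(2)[of z] h by simp
  with \<delta>(2)[of h] h show False by simp
qed

text \<open>The mirror image of \<open>x\<close> in the hyperplane where coordinate \<open>i\<close>
  equals \<open>c\<close>.\<close>

definition reflect :: "'n \<Rightarrow> real \<Rightarrow> real ^ 'n::finite \<Rightarrow> real ^ 'n" where
  "reflect i c x = x + (2 * (c - x $ i)) *\<^sub>R axis i 1"

lemma reflect_axis:
  "reflect i c (x + h *\<^sub>R axis j 1) = reflect i c x + ((if j = i then - 1 else 1) * h) *\<^sub>R axis j 1"
  by (auto simp: reflect_def vec_eq_iff axis_def algebra_simps)

lemma continuous_on_reflect: "continuous_on S (reflect i c)"
  unfolding reflect_def by (intro continuous_intros)

lemma power2_norm_add_axis: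
  fixes v :: "real ^ 'n::finite"
  shows "(norm (v + h *\<^sub>R axis j 1))\<^sup>2 = (norm v)\<^sup>2 + 2 * h * v $ j + h\<^sup>2"
  unfolding power2_norm_eq_inner
  by (simp add: inner_add inner_axis inner_axis' inner_axis_axis algebra_simps power2_eq_square)

text \<open>Maximum principle on a half ball. The right-hand side is a strictly superharmonic barrier: it is
  nonnegative on the flat side, where the left-hand side vanishes, and at least \<open>2 M\<close> on the
  spherical side.\<close>

lemma reflect_le_barrier:
  fixes u :: "real ^ 'n::finite \<Rightarrow> real"
  assumes u: "Ck_on 2 u UNIV"
    and harm: "\<And>p. (\<Sum>j\<in>UNIV. partial_deriv j (partial_deriv j u) p) = 0"
    and M: "M > 0" "\<And>p. \<bar>u p\<bar> \<le> M"
    and x: "x $ i \<ge> c" "norm (x - c *\<^sub>R axis i 1) \<le> R" and R: "R > 0"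
  shows "u x - u (reflect i c x) \<le>
    2 * M * ((norm (x - c *\<^sub>R axis i 1))\<^sup>2 / R\<^sup>2 + (real CARD('n) + 1) * ((x $ i - c) / R - (x $ i - c)\<^sup>2 / R\<^sup>2))"
proof -
  define a :: "real ^ 'n" where "a = c *\<^sub>R axis i 1"
  \<comment> \<open>In units of \<open>2 * M / R\<^sup>2\<close>, the squared norm in the barrier
    has Laplacian \<open>2 * CARD('n)\<close> and the concave term contributes
    \<open>- 2 * N\<close>. Taking \<open>N\<close> one larger than the dimension leaves the total
    \<open>- 2\<close>.\<close>
  define N where "N = real CARD('n) + 1"
  define b where "b x = 2 * M * ((norm (x - a))\<^sup>2 / R\<^sup>2 + N * ((x $ i - c) / R - (x $ i - c)\<^sup>2 / R\<^sup>2))" for x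
  define v where "v x = u x - u (reflect i c x) - b x" for x
  define K where "K = cball a R \<inter> {x. x $ i \<ge> c}"
  have d1: "u differentiable (at q)" and d2: "partial_deriv k u differentiable (at q)" for k q
    using Ck_on_2D(1)[OF u] Ck_on_1D(1)[OF Ck_on_2D(2)[OF u]] by blast+
  have cu: "continuous_on S u" for S
    using Ck_on_continuous[OF u] continuous_on_subset by blast
  have "continuous_on K v"
    unfolding v_def b_def
    by (intro continuous_intros cu continuous_on_compose2[OF cu continuous_on_reflect] order.refl) (use R in auto)
  moreover have "compact K"
    unfolding K_def by (intro compact_Int_closed closed_Collect_le continuous_intros) simp
  moreover have xK: "x \<in> K"
    using x by (simp add: K_def a_def dist_norm norm_minus_commute)
  ultimately obtain x0 where x0: "x0 \<in> K" "\<And>y. y \<in> K \<Longrightarrow> v y \<le> v x0"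
    using continuous_attains_sup[of K v] by blast
  define s where "s = x0 $ i - c"
  have s: "0 \<le> s" "s \<le> norm (x0 - a)" "norm (x0 - a) \<le> R"
    using x0(1) component_le_norm_cart[of "x0 - a" i]
    by (auto simp: K_def s_def a_def dist_norm norm_minus_commute axis_def)
  have "s * s \<le> s * R"
    using s by (intro mult_left_mono) auto
  then have "s / R - s\<^sup>2 / R\<^sup>2 \<ge> 0"
    using R by (simp add: field_simps power2_eq_square)
  then have barrier: "N * (s / R - s\<^sup>2 / R\<^sup>2) \<ge> 0"
    by (simp add: N_def)
  have "v x0 \<le> 0"
  \<comment> \<open>A positive maximum of \<open>v\<close> on the half ball can lie neither on the
    flat side nor on the sphere, so it is interior and the second derivative test applies along
    every axis.\<close>
  proof (rule ccontr)
    assume pos: "\<not> v x0 \<le> 0"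
    have "s \<noteq> 0"
    proof
      assume "s = 0"
      then have "reflect i c x0 = x0" by (simp add: reflect_def s_def)
      moreover have "b x0 \<ge> 0"
        using barrier M(1) unfolding b_def s_def[symmetric] by simp
      ultimately show False using pos by (simp add: v_def)
    qed
    moreover have "norm (x0 - a) \<noteq> R"
    proof
      assume "norm (x0 - a) = R"
      then have "b x0 \<ge> 2 * M * 1"
        using barrier M(1) R unfolding b_def s_def[symmetric] by (intro mult_left_mono) auto
      then show False
        using pos M(2)[of x0] M(2)[of "reflect i c x0"] by (simp add: v_def)
    qed
    ultimately have s': "0 < s" "norm (x0 - a) < R" using s by auto
    define \<delta> where "\<delta> = min s (R - norm (x0 - a))"
    have \<delta>: "\<delta> > 0" using s' by (simp add: \<delta>_def)
    \<comment> \<open>Moving by \<open>h\<close> along axis \<open>j\<close> changes coordinate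
      \<open>i\<close> by \<open>\<kappa> j * h\<close> and moves the mirror image by
      \<open>\<epsilon> j * h\<close> along the same axis.\<close>
    define \<kappa> where "\<kappa> j = (if j = i then 1 else 0 :: real)" for j
    define \<epsilon> where "\<epsilon> j = (if j = i then - 1 else 1 :: real)" for j
    have inK: "x0 + h *\<^sub>R axis j 1 \<in> K" if "\<bar>h\<bar> < \<delta>" for h j
    proof -
      have "norm ((x0 - a) + h *\<^sub>R axis j 1) \<le> norm (x0 - a) + \<bar>h\<bar>"
        using norm_triangle_ineq[of "x0 - a" "h *\<^sub>R axis j 1"] by simp
      moreover have "dist a (x0 + h *\<^sub>R axis j 1) = norm ((x0 - a) + h *\<^sub>R axis j 1)"
        by (simp add: dist_norm norm_minus_commute algebra_simps)
      moreover have "\<bar>h * axis j 1 $ i\<bar> \<le> \<bar>h\<bar>"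
        by (simp add: axis_def)
      then have "h * axis j 1 $ i \<ge> - \<bar>h\<bar>" by linarith
      ultimately show ?thesis
        using that by (simp add: K_def \<delta>_def s_def)
    qed
    \<comment> \<open>The second derivative of the barrier along axis \<open>j\<close>.\<close>
    define B where "B j = 2 * M * (2 / R\<^sup>2 - N * (2 * \<kappa> j / R\<^sup>2))" for j
    have le: "partial_deriv j (partial_deriv j u) x0 - partial_deriv j (partial_deriv j u) (reflect i c x0) - B j \<le> 0" for j
    proof (rule second_derivative_nonpos_at_local_max[where \<phi> = "\<lambda>h. v (x0 + h *\<^sub>R axis j 1)", OF _ _ \<delta>])
      define k where "k = inverse R"
      let ?b = "\<lambda>h. 2 * M * (((norm (x0 - a))\<^sup>2 + 2 * h * (x0 - a) $ j + h\<^sup>2) * k\<^sup>2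
        + N * ((s + \<kappa> j * h) * k - (s + \<kappa> j * h)\<^sup>2 * k\<^sup>2))"
      let ?b' = "\<lambda>h. 2 * M * ((2 * (x0 - a) $ j + 2 * h) * k\<^sup>2
        + N * (\<kappa> j * k - 2 * (s + \<kappa> j * h) * \<kappa> j * k\<^sup>2))"
      let ?\<phi>' = "\<lambda>h. partial_deriv j u (x0 + h *\<^sub>R axis j 1)
        - \<epsilon> j * partial_deriv j u (reflect i c x0 + (\<epsilon> j * h) *\<^sub>R axis j 1) - ?b' h"
      have "b (x0 + h *\<^sub>R axis j 1) = ?b h" for h
      proof -
        have "x0 + h *\<^sub>R axis j 1 - a = (x0 - a) + h *\<^sub>R axis j 1"
          by simp
        moreover have "(x0 + h *\<^sub>R axis j 1) $ i - c = s + \<kappa> j * h"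
          by (simp add: \<kappa>_def s_def axis_def)
        ultimately show ?thesis
          unfolding b_def k_def by (simp only: power2_norm_add_axis divide_inverse power_inverse)
      qed
      then have eq: "v (x0 + h *\<^sub>R axis j 1)
          = u (x0 + h *\<^sub>R axis j 1) - u (reflect i c x0 + (\<epsilon> j * h) *\<^sub>R axis j 1) - ?b h" for h
        unfolding v_def reflect_axis \<epsilon>_def by simp
      have b': "(?b has_real_derivative ?b' h) (at h)" for h
        by (auto intro!: derivative_eq_intros simp: algebra_simps)
      have "(?b' has_real_derivative 2 * M * (2 * k\<^sup>2 - N * (2 * (\<kappa> j * \<kappa> j) * k\<^sup>2))) (at 0)"
        by (auto intro!: derivative_eq_intros simp: algebra_simps)
      moreover have "\<kappa> j * \<kappa> j = \<kappa> j"
        by (simp add: \<kappa>_def)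
      ultimately have b'': "(?b' has_real_derivative B j) (at 0)"
        by (simp only: B_def k_def divide_inverse power_inverse)
      show "((\<lambda>h. v (x0 + h *\<^sub>R axis j 1)) has_real_derivative ?\<phi>' h) (at h)" for h
        unfolding eq
        using has_real_derivative_along_axis[where a = 1 and s = h and i = j, OF d1, of x0]
          has_real_derivative_along_axis[where a = "\<epsilon> j" and s = h and i = j, OF d1, of "reflect i c x0"]
        by (intro DERIV_diff b') simp_all
      have "(?\<phi>' has_real_derivative partial_deriv j (partial_deriv j u) x0
          - \<epsilon> j * (\<epsilon> j * partial_deriv j (partial_deriv j u) (reflect i c x0)) - B j) (at 0)"
        using has_real_derivative_along_axis[where a = 1 and s = 0 and i = j, OF d2, of j x0]
          has_real_derivative_along_axis[where a = "\<epsilon> j" and s = 0 and i = j, OF d2, of j "reflect i c x0"]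
        by (intro DERIV_diff DERIV_cmult b'') simp_all
      moreover have "\<epsilon> j * (\<epsilon> j * r) = r" for r
        by (simp add: \<epsilon>_def)
      ultimately show "(?\<phi>' has_real_derivative partial_deriv j (partial_deriv j u) x0
          - partial_deriv j (partial_deriv j u) (reflect i c x0) - B j) (at 0)"
        by simp
      show "v (x0 + h *\<^sub>R axis j 1) \<le> v (x0 + 0 *\<^sub>R axis j 1)" if "\<bar>h\<bar> < \<delta>" for h
        using x0(2)[OF inK[OF that]] by simp
    qed
    \<comment> \<open>Summed over the axes, the terms in \<open>u\<close> drop out, because
      \<open>u\<close> is harmonic at \<open>x0\<close> and at its mirror image. The sum of
      \<open>B\<close> would have to be nonnegative, but it is strictly negative.\<close>
    have "(\<Sum>j\<in>UNIV. partial_deriv j (partial_deriv j u) x0 - partial_deriv j (partial_deriv j u) (reflect i c x0) - B j) \<le> 0"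
      by (intro sum_nonpos le)
    then have "(\<Sum>j\<in>UNIV. B j) \<ge> 0"
      by (simp add: sum_subtractf harm)
    moreover have "(\<Sum>j\<in>UNIV. B j) = 2 * M * (\<Sum>j\<in>UNIV. 2 / R\<^sup>2 - (N * 2 / R\<^sup>2) * \<kappa> j)"
      unfolding B_def by (simp add: sum_distrib_left mult.assoc)
    moreover have "(\<Sum>j\<in>UNIV. 2 / R\<^sup>2 - (N * 2 / R\<^sup>2) * \<kappa> j) = real CARD('n) * (2 / R\<^sup>2) - N * 2 / R\<^sup>2"
      unfolding sum_subtractf sum_distrib_left[symmetric] by (simp add: \<kappa>_def)
    moreover have "real CARD('n) * (2 / R\<^sup>2) - N * 2 / R\<^sup>2 = - 2 / R\<^sup>2"
      by (simp add: N_def add_divide_distrib distrib_right)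
    moreover have "2 * M * (- 2 / R\<^sup>2) < 0"
      using M(1) R by (simp add: field_simps)
    ultimately show False by simp
  qed
  with x0(2)[OF xK] show ?thesis
    by (simp add: v_def b_def a_def N_def)
qed

text \<open>For a fixed point \<open>x\<close> the barrier tends to 0 as the radius of the half ball
  grows.\<close>

lemma harmonic_le_reflect:
  fixes u :: "real ^ 'n::finite \<Rightarrow> real"
  assumes u: "Ck_on 2 u UNIV"
    and harm: "\<And>p. (\<Sum>j\<in>UNIV. partial_deriv j (partial_deriv j u) p) = 0"
    and bd: "bounded (range u)" and x: "x $ i \<ge> c"
  shows "u x \<le> u (reflect i c x)"
proof -
  obtain M where M: "M > 0" "\<And>p. \<bar>u p\<bar> \<le> M"
    using bd unfolding bounded_pos by auto
  define d s where "d = (norm (x - c *\<^sub>R axis i 1))\<^sup>2" and "s = x $ i - c"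
  define b where "b n = 2 * M * (d * (1 / real n)\<^sup>2 + (real CARD('n) + 1) * (s * (1 / real n) - s\<^sup>2 * (1 / real n)\<^sup>2))" for n
  have "b \<longlonglongrightarrow> 2 * M * (d * 0\<^sup>2 + (real CARD('n) + 1) * (s * 0 - s\<^sup>2 * 0\<^sup>2))"
    unfolding b_def by (intro tendsto_intros lim_1_over_n)
  then have "b \<longlonglongrightarrow> 0" by simp
  \<comment> \<open>The threshold ensures that \<open>x\<close> belongs to the half ball of radius
    \<open>n\<close> and that \<open>n\<close> is positive.\<close>
  moreover have "u x - u (reflect i c x) \<le> b n" if "n \<ge> nat \<lceil>norm (x - c *\<^sub>R axis i 1)\<rceil> + 1" for n
  proof -
    have "norm (x - c *\<^sub>R axis i 1) \<le> real n" "real n > 0" using that by linarith+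
    from reflect_le_barrier[OF u harm M x this] show ?thesis
      by (simp add: b_def d_def s_def power_divide)
  qed
  ultimately have "u x - u (reflect i c x) \<le> 0"
    by (intro LIMSEQ_le_const) auto
  then show ?thesis by simp
qed

text \<open>Any two points that differ in one coordinate are mirror images of each other.\<close>

theorem bounded_harmonic_partial_deriv_eq_0:
  fixes u :: "real ^ 'n::finite \<Rightarrow> real"
  assumes u: "Ck_on 2 u UNIV"
    and harm: "\<And>p. (\<Sum>j\<in>UNIV. partial_deriv j (partial_deriv j u) p) = 0"
    and bd: "bounded (range u)"
  shows "partial_deriv i u p = 0"
proof -
  have d1: "u differentiable (at q)" and d2: "partial_deriv k u differentiable (at q)" for k q
    using Ck_on_2D(1)[OF u] Ck_on_1D(1)[OF Ck_on_2D(2)[OF u]] by blast+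
  note minus = bounded_linear_minus[OF bounded_linear_ident]
  have "partial_deriv j (\<lambda>q. - u q) = (\<lambda>q. - partial_deriv j u q)" for j
    by (rule ext) (rule partial_deriv_bounded_linear[OF minus d1])
  moreover have "partial_deriv j (\<lambda>q. - partial_deriv j u q) q = - partial_deriv j (partial_deriv j u) q" for j q
    by (rule partial_deriv_bounded_linear[OF minus d2])
  ultimately have harm': "(\<Sum>j\<in>UNIV. partial_deriv j (partial_deriv j (\<lambda>q. - u q)) q) = 0" for q
    by (simp add: sum_negf harm)
  have bd': "bounded (range (\<lambda>q. - u q))"
    using bd unfolding bounded_iff by simp
  \<comment> \<open>The hyperplane halfway between the two points interchanges them. Comparison for
    \<open>u\<close> gives one inequality, comparison for \<open>- u\<close> the other.\<close>
  have eq: "u (q + h *\<^sub>R axis i 1) = u q" if "h \<ge> 0" for q h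
  proof -
    let ?x = "q + h *\<^sub>R axis i 1" and ?c = "q $ i + h / 2"
    have "2 * (?c - ?x $ i) = - h" by simp
    then have r: "reflect i ?c ?x = q"
      by (simp add: reflect_def)
    have c: "?x $ i \<ge> ?c" using that by simp
    have "u ?x \<le> u q"
      using harmonic_le_reflect[OF u harm bd c] unfolding r .
    moreover have "- u ?x \<le> - u q"
      using harmonic_le_reflect[OF Ck_on_bounded_linear[OF minus u] harm' bd' c] unfolding r .
    ultimately show ?thesis by simp
  qed
  have "u (p + h *\<^sub>R axis i 1) = u p" for h
    using eq[of h p] eq[of "- h" "p + h *\<^sub>R axis i 1"] by (cases "h \<ge> 0") simp_all
  then have "((\<lambda>s. u p) has_real_derivative partial_deriv i u p) (at 0)"
    using has_real_derivative_along_axis[where a = 1 and s = 0 and i = i, OF d1, of p] by simp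
  then show ?thesis
    by (rule DERIV_unique) (rule DERIV_const)
qed

lemma constant_if_partial_deriv_eq_0:
  fixes u :: "real ^ 'n::finite \<Rightarrow> real"
  assumes d: "\<And>p. u differentiable (at p)" and z: "\<And>i p. partial_deriv i u p = 0"
  shows "u p = u q"
proof -
  have "(u has_derivative (\<lambda>h. 0)) (at p)" for p
  proof -
    have lin: "linear (frechet_derivative u (at p))"
      by (rule has_derivative_linear[OF has_derivative_frechet[OF d]])
    have "frechet_derivative u (at p) v = 0" for v
    proof -
      have "frechet_derivative u (at p) (\<Sum>i\<in>UNIV. v $ i *\<^sub>R axis i 1) = 0"
        using z[of _ p] unfolding partial_deriv_def by (simp add: linear_sum[OF lin] linear_cmul[OF lin])
      moreover have "(\<Sum>i\<in>UNIV. v $ i *\<^sub>R axis i 1) = v"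
        using basis_expansion[of v] by (simp add: scalar_mult_eq_scaleR)
      ultimately show ?thesis by simp
    qed
    then have "frechet_derivative u (at p) = (\<lambda>h. 0)" by (rule ext)
    then show ?thesis using has_derivative_frechet[OF d, of p] by simp
  qed
  then show ?thesis
    using has_derivative_zero_constant[of UNIV u] by (metis UNIV_I convex_UNIV)
qed

subsection \<open>Antiderivatives on intervals\<close>

text \<open>\<open>J\<close> may be open, half-open or unbounded, whereas the fundamental theorem is
  applied on compact intervals. Around each \<open>u\<close> a compact subinterval is chosen that
  contains the base point \<open>c\<close> and is a neighbourhood of \<open>u\<close> relative to
  \<open>J\<close>.\<close>

lemma interval_antiderivative:
  fixes g :: "real \<Rightarrow> real"
  assumes J: "is_interval J" and g: "continuous_on J g"
  obtains G where "\<And>u. u \<in> J \<Longrightarrow> (G has_real_derivative g u) (at u within J)"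
proof (cases "J = {}")
  case False
  then obtain c where c: "c \<in> J" by blast
  have "((\<lambda>u. LBINT y=c..u. g y) has_real_derivative g u) (at u within J)" if u: "u \<in> J" for u
  proof -
    \<comment> \<open>\<open>a\<close> lies strictly to the left of \<open>u\<close> unless
      \<open>u\<close> is the least element of \<open>J\<close>; \<open>b\<close> plays the same
      part on the right.\<close>
    obtain a where a: "a \<in> J" "a \<le> u" "a < u \<or> (\<forall>x\<in>J. u \<le> x)"
      using u by (metis le_less linorder_not_less)
    obtain b where b: "b \<in> J" "u \<le> b" "u < b \<or> (\<forall>x\<in>J. x \<le> u)"
      using u by (metis le_less linorder_not_less)
    define a' b' where "a' = min a c" and "b' = max b c"
    have "a' \<in> J" "b' \<in> J"
      using a(1) b(1) c by (auto simp: a'_def b'_def min_def max_def)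
    then have sub: "{a'..b'} \<subseteq> J"
      using J unfolding is_interval_1 by (meson atLeastAtMost_iff subsetI)
    have "((\<lambda>u. LBINT y=c..u. g y) has_vector_derivative g u) (at u within {a'..b'})"
      by (rule interval_integral_FTC2)
        (use a b continuous_on_subset[OF g sub] in \<open>auto simp: a'_def b'_def\<close>)
    moreover
    \<comment> \<open>An open set around \<open>u\<close> in which \<open>J\<close> does not leave
      the interval from \<open>a\<close> to \<open>b\<close>.\<close>
    define S where "S = (if a < u then {a<..} else UNIV) \<inter> (if u < b then {..<b} else UNIV)"
    have "at u within J = at u within {a'..b'}"
    proof (rule at_within_nhd)
      show "u \<in> S" "open S" by (auto simp: S_def)
      have "a \<le> x \<and> x \<le> b" if "x \<in> J" "x \<in> S" for x
        using a b that by (auto simp: S_def split: if_splits)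
      then have "J \<inter> S \<subseteq> {a'..b'}"
        by (auto simp: a'_def b'_def min.coboundedI1 max.coboundedI1)
      with sub show "J \<inter> S - {u} = {a'..b'} \<inter> S - {u}"
        by blast
    qed
    ultimately show ?thesis
      by (simp add: has_real_derivative_iff_has_vector_derivative)
  qed
  then show ?thesis by (rule that)
qed (use that in auto)

lemma nondecreasing_if_deriv_nonneg_on_interval:
  fixes f :: "real \<Rightarrow> real"
  assumes "\<And>u. u \<in> {a..b} \<Longrightarrow> (f has_real_derivative f' u) (at u within {a..b})"
    and "\<And>u. u \<in> {a..b} \<Longrightarrow> f' u \<ge> 0" and "a \<le> b"
  shows "f a \<le> f b"
proof (rule DERIV_nonneg_imp_increasing_open[OF assms(3)])
  show "continuous_on {a..b} f"
    using assms(1) by (rule DERIV_continuous_on)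
  fix x assume x: "a < x" "x < b"
  then have "at x within {a..b} = at x"
    by (intro at_within_interior) simp
  with assms(1)[of x] assms(2)[of x] x show "\<exists>y. (f has_real_derivative y) (at x) \<and> 0 \<le> y"
    by auto
qed

text \<open>The hypothesis says that \<open>\<bar>(ln g)' u\<bar> \<le> q / \<bar>u\<bar>\<close>. Hence \<open>u g(u)\<close> increases at least as fast as
  \<open>(1 - q) G\<close>, and it stays bounded because \<open>g(u) / u\<close> decreases away from \<open>0\<close>.\<close>

lemma bounded_antiderivative:
  fixes g g' G :: "real \<Rightarrow> real"
  assumes J: "is_interval J" "bounded J"
    and g: "\<And>u. u \<in> J \<Longrightarrow> g u > 0"
    and g': "\<And>u. u \<in> J \<Longrightarrow> (g has_real_derivative g' u) (at u within J)"
    and G: "\<And>u. u \<in> J \<Longrightarrow> (G has_real_derivative g u) (at u within J)"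
    and q: "q < 1" "\<And>u. u \<in> J \<Longrightarrow> \<bar>u * g' u\<bar> \<le> q * g u"
  shows "bounded (G ` J)"
proof (cases "J = {}")
  case False
  have sub: "{a..b} \<subseteq> J" if "a \<in> J" "b \<in> J" for a b
    using J(1) that unfolding is_interval_1 by (meson atLeastAtMost_iff subsetI)
  have g'': "(g has_real_derivative g' u) (at u within {a..b})" and G': "(G has_real_derivative g u) (at u within {a..b})"
    if "a \<in> J" "b \<in> J" "u \<in> {a..b}" for a b u
    using sub[OF that(1,2)] that(3) g'[of u] G[of u] DERIV_subset by blast+
  \<comment> \<open>The first estimate compares the derivatives of \<open>u * g u\<close> and
    \<open>(1 - q) * G u\<close>; the second gives the sign of the derivative of
    \<open>g u / u\<close>.\<close>
  have ug_nn: "g u + u * g' u \<ge> (1 - q) * g u" "u * g' u \<le> g u" "(1 - q) * g u \<ge> 0" if "u \<in> J" for u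
  proof -
    have "(1 - q) * g u \<ge> 0" using q(1) g[OF that] by simp
    then show "g u + u * g' u \<ge> (1 - q) * g u" "u * g' u \<le> g u" "(1 - q) * g u \<ge> 0"
      using q(2)[OF that] by (auto simp: algebra_simps abs_le_iff)
  qed
  have ug_mono: "a * g a \<le> b * g b" if ab: "a \<in> J" "b \<in> J" "a \<le> b" for a b
  proof (rule nondecreasing_if_deriv_nonneg_on_interval[OF _ _ ab(3)])
    fix u assume u: "u \<in> {a..b}"
    show "((\<lambda>u. u * g u) has_real_derivative g u + u * g' u) (at u within {a..b})"
      using g''[OF ab(1,2) u] by (auto intro!: derivative_eq_intros)
    have "u \<in> J" using sub[OF ab(1,2)] u by blast
    from ug_nn[OF this] show "g u + u * g' u \<ge> 0" by linarith
  qed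
  have G_le: "(1 - q) * (G b - G a) \<le> b * g b - a * g a" if ab: "a \<in> J" "b \<in> J" "a \<le> b" for a b
  proof -
    have "a * g a - (1 - q) * G a \<le> b * g b - (1 - q) * G b"
    proof (rule nondecreasing_if_deriv_nonneg_on_interval[OF _ _ ab(3)])
      fix u assume u: "u \<in> {a..b}"
      show "((\<lambda>u. u * g u - (1 - q) * G u) has_real_derivative g u + u * g' u - (1 - q) * g u) (at u within {a..b})"
        using g''[OF ab(1,2) u] G'[OF ab(1,2) u] by (auto intro!: derivative_eq_intros)
      have "u \<in> J" using sub[OF ab(1,2)] u by blast
      from ug_nn[OF this] show "g u + u * g' u - (1 - q) * g u \<ge> 0" by linarith
    qed
    then show ?thesis by (simp add: algebra_simps)
  qed
  have G_mono: "G a \<le> G b" if ab: "a \<in> J" "b \<in> J" "a \<le> b" for a b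
  proof (rule nondecreasing_if_deriv_nonneg_on_interval[OF G'[OF ab(1,2)] _ ab(3)])
    show "g u \<ge> 0" if "u \<in> {a..b}" for u
      using g[of u] sub[OF ab(1,2)] that by force
  qed
  have gu_anti: "g b / b \<le> g a / a" if ab: "a \<in> J" "b \<in> J" "a \<le> b" and z: "0 \<notin> {a..b}" for a b
  proof -
    have "- (g a / a) \<le> - (g b / b)"
    proof (rule nondecreasing_if_deriv_nonneg_on_interval[OF _ _ ab(3)])
      fix u assume u: "u \<in> {a..b}"
      have "u \<noteq> 0" using u z by auto
      then show "((\<lambda>u. - (g u / u)) has_real_derivative (g u - u * g' u) / (u * u)) (at u within {a..b})"
        using g''[OF ab(1,2) u] by (auto intro!: derivative_eq_intros simp: field_simps)
      have "u \<in> J" using sub[OF ab(1,2)] u by blast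
      from ug_nn(2)[OF this] show "(g u - u * g' u) / (u * u) \<ge> 0" by simp
    qed
    then show ?thesis by simp
  qed
  obtain B where B: "\<And>u. u \<in> J \<Longrightarrow> \<bar>u\<bar> \<le> B"
    using J(2) unfolding bounded_iff by auto
  have sq: "u\<^sup>2 \<le> B\<^sup>2" if "u \<in> J" for u
    using B[OF that] by (metis abs_ge_zero power2_abs power_mono)
  \<comment> \<open>Up to a positive point \<open>c\<close>, monotonicity of \<open>u * g u\<close>
    suffices. Beyond \<open>c\<close>, write it as \<open>u\<^sup>2 * (g u / u)\<close> and use that
    the quotient decreases. Without positive points the product is at most 0.\<close>
  have "\<exists>K. \<forall>u\<in>J. u * g u \<le> K"
  proof (cases "\<exists>c\<in>J. c > 0")
    case True
    then obtain c where c: "c \<in> J" "c > 0" by blast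
    have "u * g u \<le> max (c * g c) (B\<^sup>2 * (g c / c))" if u: "u \<in> J" for u
    proof (cases "u \<le> c")
      case True
      then show ?thesis using ug_mono[OF u c(1)] by simp
    next
      case False
      have "u * g u = u\<^sup>2 * (g u / u)" using False c by (simp add: power2_eq_square)
      also have "\<dots> \<le> B\<^sup>2 * (g c / c)"
        using gu_anti[OF c(1) u] False c sq[OF u] g[OF u] g[OF c(1)] by (intro mult_mono) auto
      finally show ?thesis by simp
    qed
    then show ?thesis by blast
  next
    case False
    then have "u * g u \<le> 0" if "u \<in> J" for u
      using that g[OF that] by (meson mult_nonpos_nonneg less_imp_le not_le)
    then show ?thesis by blast
  qed
  then obtain K1 where K1: "\<And>u. u \<in> J \<Longrightarrow> u * g u \<le> K1" by blast
  \<comment> \<open>The mirror image of the upper bound: to the left of a negative \<open>c\<close>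
    the quotient \<open>- (g u / u)\<close> is at most its value at \<open>c\<close>.\<close>
  have "\<exists>K. \<forall>u\<in>J. K \<le> u * g u"
  proof (cases "\<exists>c\<in>J. c < 0")
    case True
    then obtain c where c: "c \<in> J" "c < 0" by blast
    have "min (c * g c) (- (B\<^sup>2 * (- (g c / c)))) \<le> u * g u" if u: "u \<in> J" for u
    proof (cases "c \<le> u")
      case True
      then show ?thesis using ug_mono[OF c(1) u] by simp
    next
      case False
      have "- (u * g u) = u\<^sup>2 * (- (g u / u))" using False c by (simp add: power2_eq_square)
      also have "\<dots> \<le> B\<^sup>2 * (- (g c / c))"
        using gu_anti[OF u c(1)] False c sq[OF u] g[OF u] g[OF c(1)]
        by (intro mult_mono) (auto simp: divide_nonneg_neg divide_le_0_iff)
      finally show ?thesis by simp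
    qed
    then show ?thesis by blast
  next
    case False
    then have "0 \<le> u * g u" if "u \<in> J" for u
      using that g[OF that] by (meson mult_nonneg_nonneg less_imp_le not_le)
    then show ?thesis by blast
  qed
  then obtain K2 where K2: "\<And>u. u \<in> J \<Longrightarrow> K2 \<le> u * g u" by blast
  obtain c where c: "c \<in> J" using False by blast
  have osc: "G b - G a \<le> (K1 - K2) / (1 - q)" if ab: "a \<in> J" "b \<in> J" "a \<le> b" for a b
  proof -
    have "(1 - q) * (G b - G a) \<le> K1 - K2"
      using G_le[OF ab] K1[OF ab(2)] K2[OF ab(1)] by linarith
    then show ?thesis using q(1) by (simp add: pos_le_divide_eq mult.commute)
  qed
  have "\<bar>G u - G c\<bar> \<le> (K1 - K2) / (1 - q)" if "u \<in> J" for u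
    using osc[OF that c] osc[OF c that] G_mono[OF that c] G_mono[OF c that] by (cases "u \<le> c") auto
  then have "\<bar>G u\<bar> \<le> \<bar>G c\<bar> + (K1 - K2) / (1 - q)" if "u \<in> J" for u
    using that by (smt (verit))
  then show ?thesis
    unfolding bounded_iff by auto
qed auto

subsection \<open>Harmonicity and rigidity\<close>

text \<open>The chain rule is used twice: \<open>g \<circ> y\<close> is of class C^1, and so is its
  product with each first derivative of \<open>y\<close>.\<close>

lemma Ck_on_2_compose_real:
  fixes y :: "real ^ 'n::finite \<Rightarrow> real"
  assumes y: "Ck_on 2 y UNIV"
    and G: "\<And>v. v \<in> range y \<Longrightarrow> (G has_real_derivative g v) (at v within range y)"
    and g: "\<And>v. v \<in> range y \<Longrightarrow> (g has_real_derivative g' v) (at v within range y)"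
    and g': "continuous_on (range y) g'"
  shows "Ck_on 2 (\<lambda>p. G (y p)) UNIV"
proof -
  note dy = Ck_on_2D(1)[OF y] and Dy = Ck_on_2D(2)[OF y]
  have "continuous_on UNIV (\<lambda>p. g' (y p) * partial_deriv i y p)" for i
    by (intro continuous_intros continuous_on_compose2[OF g' Ck_on_continuous[OF y]] Ck_on_continuous[OF Dy] order.refl)
  then have gy: "Ck_on (Suc 0) (\<lambda>p. g (y p)) UNIV"
    by (intro Ck_on_SucI[OF partial_deriv_compose_real[OF dy g]]) simp_all
  have "Ck_on 1 (\<lambda>p. g (y p) * partial_deriv i y p) UNIV" for i
    by (intro Ck_on_mult Dy) (use gy in simp)
  then have "Ck_on (Suc 1) (\<lambda>p. G (y p)) UNIV"
    by (intro Ck_on_SucI[OF partial_deriv_compose_real[OF dy G]]) (simp_all del: One_nat_def)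
  then show ?thesis by (simp only: Suc_1)
qed

text \<open>Integrating by parts, the first variation becomes \<open>\<integral> 2 \<phi> \<partial>\<^sub>\<gamma>u \<Delta>u\<close>. So \<open>\<Delta>u\<close> vanishes where
  \<open>\<nabla>u \<noteq> 0\<close>, trivially in the interior of \<open>{\<nabla>u = 0}\<close>, and hence everywhere by continuity.\<close>

lemma harmonic_if_critical:
  fixes u :: "real ^ 'n::finite \<Rightarrow> real"
  assumes u: "Ck_on 2 u UNIV"
    and crit: "\<And>\<phi> \<gamma>. test_function UNIV \<phi> \<Longrightarrow>
      (LINT p|lborel. (\<Sum>\<beta>\<in>UNIV. (partial_deriv \<beta> u p)\<^sup>2) * partial_deriv \<gamma> \<phi> p
        - 2 * (\<Sum>\<beta>\<in>UNIV. partial_deriv \<beta> u p * partial_deriv \<gamma> u p * partial_deriv \<beta> \<phi> p)) = 0"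
  shows "(\<Sum>\<beta>\<in>UNIV. partial_deriv \<beta> (partial_deriv \<beta> u) p) = 0"
proof -
  define L where "L p = (\<Sum>\<beta>\<in>UNIV. partial_deriv \<beta> (partial_deriv \<beta> u) p)" for p
  have cL: "continuous_on UNIV L"
    unfolding L_def by (intro continuous_intros Ck_on_1D(2)[OF Ck_on_2D(2)[OF u]])
  have cD: "continuous_on UNIV (partial_deriv i u)" for i
    by (rule Ck_on_continuous[OF Ck_on_2D(2)[OF u]])
  have key: "2 * (partial_deriv \<gamma> u p * L p) = 0" for \<gamma> p
  proof (rule fundamental_lemma_calculus_of_variations[where F = "\<lambda>p. 2 * (partial_deriv \<gamma> u p * L p)"])
    show "continuous_on UNIV (\<lambda>p. 2 * (partial_deriv \<gamma> u p * L p))"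
      by (intro continuous_intros cL cD)
    fix \<phi> :: "real ^ 'n \<Rightarrow> real" assume \<phi>: "test_function UNIV \<phi>"
    then have \<phi>1: "Ck_on 1 \<phi> UNIV"
      unfolding test_function_def by (rule conjunct1[THEN spec])
    obtain R where R: "\<And>x. norm x > R \<Longrightarrow> \<phi> x = 0"
      using test_function_bounded_support[OF \<phi>] by blast
    \<comment> \<open>These compactly supported products are the fluxes of the integration by parts;
      the integrals of their derivatives vanish.\<close>
    define \<psi> where "\<psi> i j p = \<phi> p * (partial_deriv i u p * partial_deriv j u p)" for i j p
    have \<psi>1: "Ck_on 1 (\<psi> i j) UNIV" for i j
      unfolding \<psi>_def by (intro Ck_on_mult \<phi>1 Ck_on_2D(2)[OF u])
    have \<psi>R: "\<psi> i j x = 0" if "norm x > R" for i j x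
      using R[OF that] by (simp add: \<psi>_def)
    note int0 = integral_partial_deriv_eq_0[OF \<psi>1 \<psi>R]
    have D\<psi>: "partial_deriv k (\<psi> i j) p = \<phi> p * (partial_deriv i u p * partial_deriv k (partial_deriv j u) p
        + partial_deriv k (partial_deriv i u) p * partial_deriv j u p)
        + partial_deriv k \<phi> p * (partial_deriv i u p * partial_deriv j u p)" for i j k p
    proof -
      note d = Ck_on_1D(1)[OF Ck_on_2D(2)[OF u]]
      have "(\<lambda>p. partial_deriv i u p * partial_deriv j u p) differentiable (at p)"
        by (rule Ck_on_1D(1)) (intro Ck_on_mult Ck_on_2D(2)[OF u])
      then show ?thesis
        unfolding \<psi>_def by (simp only: partial_deriv_mult Ck_on_1D(1)[OF \<phi>1] d)
    qed
    \<comment> \<open>The product rule produces two terms with mixed second derivatives of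
      \<open>u\<close>; they cancel by symmetry, and only the pure second derivatives remain, which
      form \<open>L\<close>.\<close>
    have "(\<Sum>\<beta>\<in>UNIV. (partial_deriv \<beta> u p)\<^sup>2) * partial_deriv \<gamma> \<phi> p
        - 2 * (\<Sum>\<beta>\<in>UNIV. partial_deriv \<beta> u p * partial_deriv \<gamma> u p * partial_deriv \<beta> \<phi> p)
      = (\<Sum>\<beta>\<in>UNIV. partial_deriv \<gamma> (\<psi> \<beta> \<beta>) p - 2 * partial_deriv \<beta> (\<psi> \<beta> \<gamma>) p)
        + \<phi> p * (2 * (partial_deriv \<gamma> u p * L p))" for p
      unfolding L_def sum_distrib_left sum_distrib_right sum_subtractf[symmetric] sum.distrib[symmetric]
    proof (rule sum.cong[OF refl])
      fix \<beta>
      show "(partial_deriv \<beta> u p)\<^sup>2 * partial_deriv \<gamma> \<phi> p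
          - 2 * (partial_deriv \<beta> u p * partial_deriv \<gamma> u p * partial_deriv \<beta> \<phi> p)
        = partial_deriv \<gamma> (\<psi> \<beta> \<beta>) p - 2 * partial_deriv \<beta> (\<psi> \<beta> \<gamma>) p
          + \<phi> p * (2 * (partial_deriv \<gamma> u p * partial_deriv \<beta> (partial_deriv \<beta> u) p))"
        unfolding D\<psi> partial_deriv_commute[OF u, of \<beta> \<gamma>] by (simp add: algebra_simps power2_eq_square)
    qed
    then have "(LINT p|lborel. (\<Sum>\<beta>\<in>UNIV. partial_deriv \<gamma> (\<psi> \<beta> \<beta>) p - 2 * partial_deriv \<beta> (\<psi> \<beta> \<gamma>) p)
        + \<phi> p * (2 * (partial_deriv \<gamma> u p * L p))) = 0"
      using crit[OF \<phi>, of \<gamma>] by simp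
    moreover have "integrable lborel (\<lambda>p. \<phi> p * (2 * (partial_deriv \<gamma> u p * L p)))"
    proof (rule integrable_continuous_bounded_support)
      show "continuous_on UNIV (\<lambda>p. \<phi> p * (2 * (partial_deriv \<gamma> u p * L p)))"
        by (intro continuous_intros cL cD Ck_on_continuous[OF \<phi>1])
      show "\<phi> x * (2 * (partial_deriv \<gamma> u x * L x)) = 0" if "norm x > R" for x
        using R[OF that] by simp
    qed
    ultimately show "(LINT p|lborel. \<phi> p * (2 * (partial_deriv \<gamma> u p * L p))) = 0"
      by (simp add: int0)
  qed
  have "L p = 0"
  proof (rule ccontr)
    assume "L p \<noteq> 0"
    have "open {q. L q \<noteq> 0}"
      by (intro open_Collect_neq cL continuous_intros)
    moreover have grad: "partial_deriv i u q = 0" if "q \<in> {q. L q \<noteq> 0}" for i q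
      using key[of i q] that by simp
    ultimately have "partial_deriv i (partial_deriv i u) p = 0" for i
    proof -
      have "(partial_deriv i u has_derivative (\<lambda>h. 0)) (at p)"
        by (rule has_derivative_transform_within_open[OF has_derivative_const[of 0] \<open>open {q. L q \<noteq> 0}\<close>])
          (use \<open>L p \<noteq> 0\<close> grad in auto)
      then show ?thesis by (rule partial_deriv_eq)
    qed
    with \<open>L p \<noteq> 0\<close> show False by (simp add: L_def)
  qed
  then show ?thesis by (simp add: L_def)
qed

theorem corollary4p2:
  fixes H H' H'' :: "real \<Rightarrow> real" and I :: "real set"
    and y t :: "real ^ 'n::finite \<Rightarrow> real" and f :: "real ^ 'n \<Rightarrow> heis"
  assumes "C2_on_interval I H H' H''"
    and "range y \<subseteq> I"
    and "\<And>p. f p = (Complex (H (y p)) (y p), t p)"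
    and "harmonic_curve_on UNIV f"
    and "(SUP p. ereal \<bar>H'' (y p) * H' (y p) / (1 + (H' (y p))\<^sup>2) * y p\<bar>) < 1"
    and "bounded (range y)"
  shows "f constant_on UNIV"
proof -
  \<comment> \<open>The work takes place on the range of \<open>y\<close> rather than on
    \<open>I\<close>: the supremum controls \<open>H\<close> only there, and the range is a bounded
    interval.\<close>
  let ?J = "range y"
  define g where "g v = sqrt (1 + (H' v)\<^sup>2)" for v
  define g' where "g' v = H' v * H'' v / g v" for v
  have g_pos: "g v > 0" and g_nz: "g v \<noteq> 0" and g_sq: "(g v)\<^sup>2 = 1 + (H' v)\<^sup>2" for v
    using add_pos_nonneg[of 1 "(H' v)\<^sup>2"] by (simp_all add: g_def)
  have f2: "Ck_on 2 f UNIV" and contact: "contact_on UNIV f" and crit: "critical_on UNIV (\<lambda>p. fst (f p))"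
    using assms(4) unfolding harmonic_curve_on_def by blast+
  have y2: "Ck_on 2 y UNIV"
    using Ck_on_bounded_linear[OF bounded_linear_compose[OF bounded_linear_Im bounded_linear_fst] f2]
    by (simp add: assms(3))
  note dy = Ck_on_2D(1)[OF y2]
  have H: "(H has_real_derivative H' v) (at v within ?J)" "(H' has_real_derivative H'' v) (at v within ?J)"
    if "v \<in> ?J" for v
    using assms(1) subsetD[OF assms(2) that] unfolding C2_on_interval_def
    by (auto intro: DERIV_subset[OF _ assms(2)])
  have cH'': "continuous_on ?J H''"
    using assms(1) unfolding C2_on_interval_def by (auto intro: continuous_on_subset[OF _ assms(2)])
  have cH': "continuous_on ?J H'"
    using H(2) by (rule DERIV_continuous_on)
  have J: "is_interval ?J"
    unfolding is_interval_connected_1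
    by (rule connected_continuous_image[OF Ck_on_continuous[OF y2] connected_UNIV])
  have cg: "continuous_on ?J g"
    unfolding g_def by (intro continuous_intros cH')
  have cg': "continuous_on ?J g'"
    unfolding g'_def by (intro continuous_intros cH' cH'' cg ballI g_nz)
  have g_deriv: "(g has_real_derivative g' v) (at v within ?J)" if "v \<in> ?J" for v
  proof -
    have g: "g = (\<lambda>v. sqrt (1 + (H' v)\<^sup>2))"
      by (rule ext) (rule g_def)
    have sqrt: "(sqrt has_real_derivative inverse (g v) / 2) (at (1 + (H' v)\<^sup>2))"
      unfolding g by (rule DERIV_real_sqrt) (rule add_pos_nonneg[OF zero_less_one zero_le_power2])
    have "((\<lambda>v. 1 + (H' v)\<^sup>2) has_real_derivative 0 + of_nat 2 * (H'' v * H' v ^ (2 - Suc 0))) (at v within ?J)"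
      by (rule DERIV_add[OF DERIV_const DERIV_power[OF H(2)[OF that]]])
    then have sq: "((\<lambda>v. 1 + (H' v)\<^sup>2) has_real_derivative 2 * (H'' v * H' v)) (at v within ?J)"
      by (rule DERIV_cong) simp
    have "(g has_real_derivative inverse (g v) / 2 * (2 * (H'' v * H' v))) (at v within ?J)"
      using DERIV_chain2[where f = sqrt and g = "\<lambda>v. 1 + (H' v)\<^sup>2", OF sqrt sq]
      by (subst g)
    then show ?thesis
      by (rule DERIV_cong) (simp add: g'_def field_simps)
  qed
  obtain G where G: "\<And>v. v \<in> ?J \<Longrightarrow> (G has_real_derivative g v) (at v within ?J)"
    using interval_antiderivative[OF J cg] by blast
  define u where "u p = G (y p)" for p
  have u2: "Ck_on 2 u UNIV"
    unfolding u_def by (rule Ck_on_2_compose_real[OF y2 G g_deriv cg'])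
  have Du: "partial_deriv i u p = g (y p) * partial_deriv i y p" for i p
    unfolding u_def by (rule partial_deriv_compose_real(2)[OF dy G]) simp
  have Dx: "partial_deriv i (\<lambda>p. H (y p)) p = H' (y p) * partial_deriv i y p" for i p
    by (rule partial_deriv_compose_real(2)[OF dy H(1)]) simp
  have harm: "(\<Sum>\<beta>\<in>UNIV. partial_deriv \<beta> (partial_deriv \<beta> u) p) = 0" for p
  proof (rule harmonic_if_critical[OF u2])
    fix \<phi> \<gamma> assume \<phi>: "test_function UNIV (\<phi> :: real ^ 'n \<Rightarrow> real)"
    \<comment> \<open>Since \<open>(g v)\<^sup>2 = 1 + (H' v)\<^sup>2\<close>, all products of first
      derivatives entering the first variation of \<open>z\<close> agree with those of the single
      function \<open>u\<close>.\<close>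
    have D: "partial_deriv \<alpha> u p * partial_deriv \<beta> u p
        = partial_deriv \<alpha> (\<lambda>q. H (y q)) p * partial_deriv \<beta> (\<lambda>q. H (y q)) p
          + partial_deriv \<alpha> y p * partial_deriv \<beta> y p" for \<alpha> \<beta> p
    proof -
      have "partial_deriv \<alpha> u p * partial_deriv \<beta> u p = (g (y p))\<^sup>2 * (partial_deriv \<alpha> y p * partial_deriv \<beta> y p)"
        by (simp add: Du power2_eq_square mult_ac)
      then show ?thesis
        unfolding g_sq by (simp add: Dx power2_eq_square algebra_simps)
    qed
    have "energy_density (\<lambda>p. fst (f p)) p = (\<Sum>\<beta>\<in>UNIV. (partial_deriv \<beta> u p)\<^sup>2)" for p
      by (simp add: energy_density_def assms(3) power2_eq_square D sum.distrib)
    then have energy: "energy_density (\<lambda>p. fst (f p)) = (\<lambda>p. \<Sum>\<beta>\<in>UNIV. (partial_deriv \<beta> u p)\<^sup>2)"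
      by (rule ext)
    show "(LINT p|lborel. (\<Sum>\<beta>\<in>UNIV. (partial_deriv \<beta> u p)\<^sup>2) * partial_deriv \<gamma> \<phi> p
        - 2 * (\<Sum>\<beta>\<in>UNIV. partial_deriv \<beta> u p * partial_deriv \<gamma> u p * partial_deriv \<beta> \<phi> p)) = 0"
      using crit[unfolded critical_on_def, rule_format, OF \<phi>, of \<gamma>]
      unfolding energy D by (simp only: assms(3) fst_conv complex.sel set_lebesgue_integral_def indicator_UNIV scaleR_one)
  qed
  \<comment> \<open>The strict bound on the supremum leaves room for a real \<open>q < 1\<close>
    valid at all points, so that one can divide by \<open>1 - q\<close>.\<close>
  obtain q where q: "(SUP p. ereal \<bar>H'' (y p) * H' (y p) / (1 + (H' (y p))\<^sup>2) * y p\<bar>) < ereal q" "q < 1"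
    using ereal_dense2[OF assms(5)] by (auto simp: one_ereal_def)
  have "\<bar>v * g' v\<bar> \<le> q * g v" if v: "v \<in> ?J" for v
  proof -
    obtain p where p: "v = y p" using v by blast
    have "ereal \<bar>H'' v * H' v / (1 + (H' v)\<^sup>2) * v\<bar> < ereal q"
      unfolding p by (rule le_less_trans[OF SUP_upper q(1)]) simp
    then have "\<bar>H'' v * H' v / (g v)\<^sup>2 * v\<bar> \<le> q"
      by (simp add: g_sq)
    then have "\<bar>H'' v * H' v / (g v)\<^sup>2 * v\<bar> * g v \<le> q * g v"
      using g_pos[of v] by (intro mult_right_mono) auto
    \<comment> \<open>The controlled quotient is the logarithmic derivative
      \<open>g' v / g v\<close>, so multiplying by \<open>g v\<close> turns it into
      \<open>g' v\<close>.\<close>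
    moreover have "\<bar>H'' v * H' v / (g v)\<^sup>2 * v\<bar> * g v = \<bar>v * g' v\<bar>"
      using g_pos[of v] by (simp add: g'_def abs_mult power2_eq_square)
    ultimately show ?thesis by simp
  qed
  then have "bounded (G ` ?J)"
    by (intro bounded_antiderivative[OF J assms(6) g_pos g_deriv G q(2)])
  then have "bounded (range u)"
    by (simp add: u_def[abs_def] image_image)
  from bounded_harmonic_partial_deriv_eq_0[OF u2 harm this]
  have "partial_deriv i y p = 0" for i p
    using Du[of i p] g_pos[of "y p"] by simp
  then have y_const: "y p = y 0" for p
    by (rule constant_if_partial_deriv_eq_0[OF dy])
  have df: "f differentiable (at p)" for p
    by (rule Ck_on_2D(1)[OF f2])
  have snd_f: "snd (f p) = t p" for p by (simp add: assms(3))
  have t2: "Ck_on 2 t UNIV"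
    using Ck_on_bounded_linear[OF bounded_linear_snd f2] by (simp add: assms(3))
  \<comment> \<open>As \<open>z\<close> is constant, the derivative of \<open>f\<close> has zero
    first component, and the contact form reduces to \<open>dt\<close>.\<close>
  have "partial_deriv i t p = 0" for i p
  proof -
    have "(\<lambda>q. fst (f q)) = (\<lambda>q. fst (f 0))"
      using y_const by (metis assms(3) fst_conv)
    then have "partial_deriv i (\<lambda>q. fst (f q)) p = 0"
      by (simp add: partial_deriv_def)
    then have "fst (partial_deriv i f p) = 0"
      using partial_deriv_bounded_linear[OF bounded_linear_fst df] by metis
    moreover have "contact_form (f p) (partial_deriv i f p) = 0"
      using contact by (simp add: contact_on_def partial_deriv_def)
    ultimately have "snd (partial_deriv i f p) = 0"
      by (simp add: contact_form_def)
    then show ?thesis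
      using partial_deriv_bounded_linear[OF bounded_linear_snd df, of i p] by (simp add: snd_f)
  qed
  then have "t p = t 0" for p
    by (rule constant_if_partial_deriv_eq_0[OF Ck_on_2D(1)[OF t2]])
  with y_const have "f p = f 0" for p
    by (metis assms(3))
  then show ?thesis
    unfolding constant_on_def by blast
qed

end
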